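(* Let $d\ge 1$ and $n\geq d+1$ be integers, and let $\xi_1,\ldots,\xi_n$ be random vectors in $\mathbb{R}^d$ (on a common probability space) with partial sums $S_i=\xi_1+\ldots+\xi_i$, $1\le i\le n$. Assume: (Symmetric exchangeability) for every permutation $\sigma$ of $\{1,\ldots,n\}$ and every $\varepsilon_1,\ldots,\varepsilon_n\in\{-1,+1\}$, the tuples $(\xi_1,\ldots,\xi_n)$ and $(\varepsilon_1\xi_{\sigma(1)},\ldots,\varepsilon_n\xi_{\sigma(n)})$ have the same distribution; (General position) for every $1\le i_1<\ldots<i_d\le n$, the probability that the vectors $S_{i_1},\ldots,S_{i_d}$ are linearly dependent is $0$. Then for every $k=1,\ldots,n$, $$ \mathbb{E}\, M_{n,k}^{(d)} = \binom{n}{k}\,\frac{B(k,d-1)+B(k,d-3)+\ldots}{2^k k!} = \binom{n}{k}\,\mathbb{E}\, M_{k,k}^{(d)}. $$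
   Context: $\operatorname{Conv}(x_1,\ldots,x_k)$ denotes the convex hull of the points $x_1,\ldots,x_k$. For $1\le k\le m\le n$, $$ M_{m,k}^{(d)} = \frac12 \sum_{1\le i_1<\ldots<i_k\le m} \mathbf{1}_{\{0\notin \operatorname{Conv}(S_{i_1},\ldots,S_{i_k})\}}; $$ in particular $M_{k,k}^{(d)}=\frac12\mathbf{1}_{\{0\notin\operatorname{Conv}(S_1,\ldots,S_k)\}}$. The numbers $B(k,j)$ are defined by $$(t+1)(t+3)\cdots(t+2k-1)=\sum_{j=0}^k B(k,j)t^j,$$ with $B(k,j)=0$ for $j<0$ and for $j>k$. The sum $B(k,d-1)+B(k,d-3)+\ldots$ runs over all indices $d-1-2r$, $r=0,1,2,\ldots$ (finitely many non-zero terms). *)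

theory Defs
  imports "HOL-Probability.Probability" "HOL-Computational_Algebra.Polynomial"
begin

definition partial_sum :: "(nat \<Rightarrow> 'w \<Rightarrow> 'v::real_vector) \<Rightarrow> nat \<Rightarrow> 'w \<Rightarrow> 'v" where
  "partial_sum \<xi> i \<omega> = (\<Sum>j=1..i. \<xi> j \<omega>)"

text \<open>
  Equality of the laws of the two \<open>n\<close>-tuples on the product space; only \<open>\<xi> 1, \<dots>, \<xi> n\<close> are
  relevant, the tuples being functions restricted to \<open>{1..n}\<close>.
\<close>
definition symmetrically_exchangeable ::
  "'w measure \<Rightarrow> nat \<Rightarrow> (nat \<Rightarrow> 'w \<Rightarrow> 'v::real_normed_vector) \<Rightarrow> bool" where
  "symmetrically_exchangeable M n \<xi> \<longleftrightarrow>
     (\<forall>\<sigma> \<epsilon>. \<sigma> permutes {1..n} \<longrightarrow> (\<forall>i\<in>{1..n}. \<epsilon> i \<in> {-1, 1::real}) \<longrightarrow>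
        distr M (\<Pi>\<^sub>M i\<in>{1..n}. borel) (\<lambda>\<omega>. \<lambda>i\<in>{1..n}. \<xi> i \<omega>) =
        distr M (\<Pi>\<^sub>M i\<in>{1..n}. borel) (\<lambda>\<omega>. \<lambda>i\<in>{1..n}. \<epsilon> i *\<^sub>R \<xi> (\<sigma> i) \<omega>))"

text \<open>
  Linear dependence of an indexed family; unlike \<^const>\<open>dependent\<close> applied to the image
  \<open>v ` I\<close>, a family with a repeated vector counts as dependent.
\<close>
definition dependent_family :: "'i set \<Rightarrow> ('i \<Rightarrow> 'v::real_vector) \<Rightarrow> bool" where
  "dependent_family I v \<longleftrightarrow>
     (\<exists>c. (\<exists>i\<in>I. c i \<noteq> 0) \<and> (\<Sum>i\<in>I. c i *\<^sub>R v i) = 0)"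

text \<open>
  Index tuples \<open>i\<^sub>1 < \<dots> < i\<^sub>d\<close> are encoded, here and below, as index sets of the
  corresponding cardinality.
\<close>
definition general_position ::
  "'w measure \<Rightarrow> nat \<Rightarrow> nat \<Rightarrow> (nat \<Rightarrow> 'w \<Rightarrow> 'v::real_vector) \<Rightarrow> bool" where
  "general_position M d n \<xi> \<longleftrightarrow>
     (\<forall>I. I \<subseteq> {1..n} \<longrightarrow> card I = d \<longrightarrow>
        measure M {\<omega> \<in> space M. dependent_family I (\<lambda>i. partial_sum \<xi> i \<omega>)} = 0)"

definition M_count :: "(nat \<Rightarrow> 'w \<Rightarrow> 'v::real_vector) \<Rightarrow> nat \<Rightarrow> nat \<Rightarrow> 'w \<Rightarrow> real" where
  "M_count \<xi> m k \<omega> =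
     1 / 2 * (\<Sum>I | I \<subseteq> {1..m} \<and> card I = k.
                of_bool (0 \<notin> convex hull ((\<lambda>i. partial_sum \<xi> i \<omega>) ` I)))"

definition B :: "nat \<Rightarrow> nat \<Rightarrow> int" where
  "B k j = coeff (\<Prod>i=1..k. [:2 * int i - 1, 1:]) j"

text \<open>
  \<open>B(k,d-1) + B(k,d-3) + \<dots>\<close> for \<open>d \<ge> 1\<close>; the terms with negative second index, which are zero
  by convention, are left out.
\<close>
definition B_sum :: "nat \<Rightarrow> nat \<Rightarrow> int" where
  "B_sum k d = (\<Sum>r | 2 * r \<le> d - 1. B k (d - 1 - 2 * r))"

end

theory Submission
  imports Defs
begin

text \<open>
  By summation by parts, zero lies in the convex hull of the partial sums of a signed permutation
  \<open>h\<close> of \<open>\<eta> 1, \<dots>, \<eta> k\<close> iff the space of linear relations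
  \<open>{a. (\<Sum>i=1..k. a i *\<^sub>R \<eta> i) = 0}\<close>, which has codimension \<open>d\<close>, meets the chamber of
  type \<open>B\<^sub>k\<close> belonging to \<open>h\<close>. In general position the number of chambers met satisfies
  \<open>r(k+1,d) = r(k,d-1) + (2k+1) r(k,d)\<close> by deletion and restriction, so that it depends on \<open>k\<close> and
  \<open>d\<close> only. For an index set \<open>i\<^sub>1 < \<dots> < i\<^sub>k\<close> the vectors \<open>\<eta> j\<close> are the sums of the \<open>\<xi> i\<close>
  over the blocks between consecutive indices. Signed permutations of the blocks preserve the law up
  to a permutation of the block lengths, and summing over all index sets absorbs the latter.
\<close>

section \<open>Type B chambers met by a generic subspace\<close>

text \<open>There are 2^k k! = (1+1)(1+3)...(1+(2k-1)) chambers, the value at t = 1 of the product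
  defining the numbers B(k,j). Its next factor t + (2k+1) mirrors the 2k+1 walls that involve
  coordinate k+1, so the recursions agree. A generic subspace of codimension d >= 1 misses
  \<open>2 * B_sum k d\<close> chambers, and the 1/2 in \<open>M_count\<close> cancels this 2. Three
  obstacles shape the proof. A convex combination has merely nonnegative coefficients, so it gives a
  point of a closed chamber; genericity has to turn this into a point of the open one. General
  position is assumed for the given order of the steps only, while the count concerns all flats of
  the arrangement; exchangeability carries it almost surely to every signed permutation. Finally,
  projecting out a coordinate turns relations into relations modulo a line, so the induction is run
  modulo a subspace \<open>W\<close>.\<close>

lemma B_0: "B 0 j = of_bool (j = 0)"
  by (simp add: B_def)

lemma B_Suc: "B (Suc k) j = (2 * int k + 1) * B k j + (if j = 0 then 0 else B k (j - 1))"
  by (simp add: B_def coeff_pCons mult.commute[of _ "[:_, _:]"] split: nat.split)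

text \<open>Sum \<open>B_Suc\<close> over the indices d-1-2r; the shifted terms have indices d-2-2r
  and make up the sum for d-1. The case d = 1 is separate because truncated subtraction makes
  \<open>B_sum k 0\<close> equal to \<open>B_sum k 1\<close> instead of zero.\<close>

lemma B_sum_Suc:
  assumes "d \<ge> 1"
  shows "B_sum (Suc k) d = (2 * int k + 1) * B_sum k d + (if d = 1 then 0 else B_sum k (d - 1))"
proof -
  have fin: "finite {r. 2 * r \<le> m}" for m :: nat
    by (rule finite_subset[of _ "{..m}"]) auto
  have *: "(\<Sum>r | 2 * r \<le> d - 1. if d - 1 - 2 * r = 0 then 0 else B k (d - 1 - 2 * r - 1))
     = (if d = 1 then 0 else B_sum k (d - 1))"
  proof (cases "d = 1")
    case False
    have "(\<Sum>r | 2 * r \<le> d - 1. if d - 1 - 2 * r = 0 then 0 else B k (d - 1 - 2 * r - 1))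
       = (\<Sum>r | 2 * r \<le> d - 1 - 1. B k (d - 1 - 1 - 2 * r))"
      using assms False
      by (intro sum.mono_neutral_cong_right) (auto simp: fin intro!: arg_cong2[where f = B])
    then show ?thesis using False by (simp add: B_sum_def)
  qed simp
  have "B_sum (Suc k) d = (\<Sum>r | 2 * r \<le> d - 1. (2 * int k + 1) * B k (d - 1 - 2 * r))
     + (\<Sum>r | 2 * r \<le> d - 1. if d - 1 - 2 * r = 0 then 0 else B k (d - 1 - 2 * r - 1))"
    unfolding B_sum_def B_Suc by (rule sum.distrib)
  then show ?thesis unfolding * by (simp add: B_sum_def sum_distrib_left)
qed

text \<open>For \<open>k \<le> d\<close> the sum takes all coefficients of one parity. The product
  is 2^k k! at t = 1 and vanishes at t = -1, so either parity contributes half of 2^k k!. In the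
  induction this is (2k+1) + 1 = 2(k+1). Geometrically, a generic subspace of codimension at least k
  meets no chamber.\<close>

lemma B_sum_saturated:
  assumes "1 \<le> k" "k \<le> d"
  shows "2 * B_sum k d = 2 ^ k * fact k"
  using assms
proof (induction k arbitrary: d rule: dec_induct)
  case base
  \<comment> \<open>For k = 0 the parity of d still matters. Exactly one of d and d-1 is odd, so
    their contributions add up to 2 at k = 1.\<close>
  have 0: "2 * B_sum 0 d = of_bool (odd d) * 2" if "d \<ge> 1" for d
  proof (cases "odd d")
    case True
    then have "B_sum 0 d = (\<Sum>r\<in>{(d - 1) div 2}. 1)"
      unfolding B_sum_def B_0 of_bool_def using that
      by (intro sum.mono_neutral_cong_right)
        (auto intro: finite_subset[of _ "{..d}"] elim!: oddE)
    then show ?thesis using True by simp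
  next
    case False
    then have "B_sum 0 d = 0"
      unfolding B_sum_def B_0 using that by (intro sum.neutral) (auto, presburger)
    then show ?thesis using False by simp
  qed
  show ?case
    using B_sum_Suc[of d 0] 0[of d] 0[of "d - 1"] base by (auto split: if_splits)
next
  case (step k)
  have "2 * B_sum (Suc k) d = (2 * int k + 1) * (2 * B_sum k d) + 2 * B_sum k (d - 1)"
    using B_sum_Suc[of d k] step by (simp add: algebra_simps)
  also have "\<dots> = (2 * int k + 1) * (2 ^ k * fact k) + 2 ^ k * fact k"
    using step.IH[of d] step.IH[of "d - 1"] step.prems by simp
  finally show ?case by (simp add: algebra_simps)
qed

text \<open>
  The wall \<open>(m, j, e)\<close> with \<open>e = \<plusminus>1\<close> is \<open>a m = e * a j\<close>; the coordinate hyperplane \<open>a m = 0\<close> is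
  encoded as \<open>(m, 0, 0)\<close>.
\<close>
definition wall :: "nat \<times> nat \<times> real \<Rightarrow> (nat \<Rightarrow> real) \<Rightarrow> real" where
  "wall p a = (case p of (m, j, e) \<Rightarrow> a m - e * a j)"

lemma wall_simp [simp]: "wall (m, j, e) a = a m - e * a j"
  by (simp add: wall_def)

section \<open>Regions of a linear set: deletion and restriction\<close>

lemma wall_linear: "wall p (\<lambda>i. a i + s * b i) = wall p a + s * wall p b"
  by (cases p) (simp add: algebra_simps)

text \<open>A region is identified with its sign pattern, recorded as the set of walls positive on
  it; counting regions thus needs no topology.\<close>

definition regions :: "(nat \<times> nat \<times> real) set \<Rightarrow> (nat \<Rightarrow> real) set \<Rightarrow> (nat \<times> nat \<times> real) set set" where
  "regions I V = (\<lambda>a. {i\<in>I. wall i a > 0}) ` {a\<in>V. \<forall>i\<in>I. wall i a \<noteq> 0}"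

definition linear_closed :: "(nat \<Rightarrow> real) set \<Rightarrow> bool" where
  "linear_closed V \<longleftrightarrow> (\<forall>a\<in>V. \<forall>b\<in>V. \<forall>s. (\<lambda>i. a i + s * b i) \<in> V)"

lemma linear_closedD: "linear_closed V \<Longrightarrow> a \<in> V \<Longrightarrow> b \<in> V \<Longrightarrow> (\<lambda>i. a i + s * b i) \<in> V"
  by (auto simp: linear_closed_def)

lemma perturb:
  fixes f g :: "'i \<Rightarrow> real"
  assumes "finite I" "\<forall>i\<in>I. f i \<noteq> 0"
  obtains t where "t > 0" "\<And>i s. i \<in> I \<Longrightarrow> \<bar>s\<bar> \<le> t \<Longrightarrow> sgn (f i + s * g i) = sgn (f i)"
proof -
  have "\<exists>t>0. \<forall>i\<in>I. \<forall>s. \<bar>s\<bar> \<le> t \<longrightarrow> sgn (f i + s * g i) = sgn (f i)"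
    using assms
  proof (induction I rule: finite_induct)
    case empty
    show ?case by (auto intro: exI[of _ 1])
  next
    case (insert x I)
    then obtain t where t: "t > 0" "\<forall>i\<in>I. \<forall>s. \<bar>s\<bar> \<le> t \<longrightarrow> sgn (f i + s * g i) = sgn (f i)"
      by auto
    \<comment> \<open>The summand 1 covers \<open>g x = 0\<close> and makes the estimate below
      strict.\<close>
    define u where "u = \<bar>f x\<bar> / (\<bar>g x\<bar> + 1)"
    have fx: "f x \<noteq> 0" using insert by simp
    have u: "u > 0" using fx by (simp add: u_def)
    have ux: "sgn (f x + s * g x) = sgn (f x)" if "\<bar>s\<bar> \<le> u" for s
    proof -
      have "\<bar>s * g x\<bar> \<le> u * \<bar>g x\<bar>" using that by (simp add: abs_mult mult_right_mono)
      also have "\<dots> < u * (\<bar>g x\<bar> + 1)" using u by simp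
      also have "\<dots> = \<bar>f x\<bar>" by (simp add: u_def)
      finally show ?thesis by (auto simp: sgn_if abs_if split: if_splits)
    qed
    show ?case
      by (rule exI[of _ "min t u"]) (use t u ux in auto)
  qed
  then show ?thesis using that by blast
qed

text \<open>
  Deletion--restriction: the patterns occurring on both sides of the wall \<open>i\<close> are those that
  occur on the wall itself, by convexity and by perturbation.
\<close>
lemma card_regions_insert:
  assumes I: "finite I" "i \<notin> I" and V: "linear_closed V" and v: "v \<in> V" "wall i v \<noteq> 0"
  shows "card (regions (insert i I) V) = card (regions I V) + card (regions I {a\<in>V. wall i a = 0})"
proof -
  define pat where "pat a = {j\<in>I. wall j a > 0}" for a
  define Y where "Y S = pat ` {a\<in>V. (\<forall>j\<in>I. wall j a \<noteq> 0) \<and> sgn (wall i a) = S}" for S :: real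
  have fin: "finite (Y S)" for S
    by (rule finite_subset[of _ "Pow I"]) (use I in \<open>auto simp: Y_def pat_def\<close>)
  have notin: "i \<notin> X" if "X \<in> Y S" for X S
    using that I by (auto simp: Y_def pat_def)
  have "regions (insert i I) V = Y (-1) \<union> insert i ` Y 1"
  proof (intro equalityI subsetI)
    fix X assume "X \<in> regions (insert i I) V"
    then obtain a where a: "a \<in> V" "\<forall>j\<in>insert i I. wall j a \<noteq> 0" "X = {j\<in>insert i I. wall j a > 0}"
      by (auto simp: regions_def)
    show "X \<in> Y (-1) \<union> insert i ` Y 1"
    proof (cases "wall i a > 0")
      case True
      then have "X = insert i (pat a)" using a by (auto simp: pat_def)
      moreover have "pat a \<in> Y 1" using a True by (auto simp: Y_def)
      ultimately show ?thesis by blast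
    next
      case False
      then have "X = pat a" using a by (auto simp: pat_def)
      moreover have "pat a \<in> Y (-1)" using a False by (auto simp: Y_def sgn_if)
      ultimately show ?thesis by blast
    qed
  next
    fix X assume "X \<in> Y (-1) \<union> insert i ` Y 1"
    then obtain a where "a \<in> V" "\<forall>j\<in>I. wall j a \<noteq> 0"
        "wall i a < 0 \<and> X = pat a \<or> wall i a > 0 \<and> X = insert i (pat a)"
      by (auto simp: Y_def sgn_if split: if_splits)
    then show "X \<in> regions (insert i I) V"
      unfolding regions_def by (intro image_eqI[of _ _ a]) (auto simp: pat_def)
  qed
  moreover have "inj_on (insert i) (Y 1)"
    using notin by (intro inj_onI) (metis insert_ident)
  moreover have "Y (-1) \<inter> insert i ` Y 1 = {}"
    using notin by auto
  ultimately have "card (regions (insert i I) V) = card (Y (-1)) + card (Y 1)"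
    by (simp add: card_Un_disjoint fin card_image)
  \<comment> \<open>Patterns seen on both sides were counted twice: the union gives the deletion,
    the intersection the restriction.\<close>
  also have "\<dots> = card (Y (-1) \<union> Y 1) + card (Y (-1) \<inter> Y 1)"
    by (rule card_Un_Int[OF fin fin])
  also have "Y (-1) \<inter> Y 1 = regions I {a\<in>V. wall i a = 0}"
  proof (intro equalityI subsetI)
    fix X assume "X \<in> Y (-1) \<inter> Y 1"
    then obtain a b where a: "a \<in> V" "\<forall>j\<in>I. wall j a \<noteq> 0" "wall i a < 0" "X = pat a"
      and b: "b \<in> V" "\<forall>j\<in>I. wall j b \<noteq> 0" "wall i b > 0" "X = pat b"
      by (auto simp: Y_def sgn_if split: if_splits)
    \<comment> \<open>The parameter at which the segment from \<open>a\<close> to \<open>b\<close>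
      crosses the wall \<open>i\<close>.\<close>
    define s where "s = - wall i a / (wall i b - wall i a)"
    have s: "0 < s" "s < 1" using a b by (auto simp: s_def field_simps)
    define c where "c = (\<lambda>n. a n + s * (b n + (-1) * a n))"
    have "c \<in> V" unfolding c_def
      by (intro linear_closedD[OF V] a b)
    have w: "wall j c = (1 - s) * wall j a + s * wall j b" for j
      unfolding c_def wall_linear by (simp add: algebra_simps)
    have "wall i c = 0" unfolding w using a b by (simp add: s_def field_simps)
    have "wall j c \<noteq> 0 \<and> (wall j c > 0 \<longleftrightarrow> wall j a > 0)" if "j \<in> I" for j
    proof (cases "wall j a > 0")
      case True
      then have "j \<in> pat a" using that by (simp add: pat_def)
      then have "j \<in> pat b" using a b by simp
      then have "wall j b > 0" by (simp add: pat_def)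
      with True s have "wall j c > 0" unfolding w by (intro add_pos_pos mult_pos_pos) auto
      then show ?thesis using True by simp
    next
      case False
      then have "j \<notin> pat a" by (simp add: pat_def)
      then have "j \<notin> pat b" using a b by simp
      then have "wall j b < 0" "wall j a < 0"
        using that a b False by (auto simp: pat_def not_less order.order_iff_strict)
      with s have "wall j c < 0" unfolding w by (intro add_neg_neg mult_pos_neg) auto
      then show ?thesis using False by simp
    qed
    then have "\<forall>j\<in>I. wall j c \<noteq> 0" "X = {j\<in>I. wall j c > 0}" using a by (auto simp: pat_def)
    then show "X \<in> regions I {a\<in>V. wall i a = 0}"
      using \<open>c \<in> V\<close> \<open>wall i c = 0\<close> by (auto simp: regions_def)
  next
    fix X assume "X \<in> regions I {a\<in>V. wall i a = 0}"
    then obtain a where a: "a \<in> V" "wall i a = 0" "\<forall>j\<in>I. wall j a \<noteq> 0" "X = pat a"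
      by (auto simp: regions_def pat_def)
    obtain t where t: "t > 0"
      "\<And>j s. j \<in> I \<Longrightarrow> \<bar>s\<bar> \<le> t \<Longrightarrow> sgn (wall j a + s * wall j v) = sgn (wall j a)"
      by (rule perturb[of I "\<lambda>j. wall j a" "\<lambda>j. wall j v"]) (use I a in auto)
    have "X \<in> Y S" if "S \<in> {-1, 1}" for S
    proof -
      \<comment> \<open>The factor \<open>sgn (wall i v)\<close> directs the move along
        \<open>v\<close> to the side \<open>S\<close> of the wall; \<open>t\<close> is small enough
        to keep all other signs.\<close>
      define s where "s = S * t * sgn (wall i v)"
      have s: "\<bar>s\<bar> \<le> t" using that t v by (auto simp: s_def abs_mult sgn_if)
      define c where "c = (\<lambda>n. a n + s * v n)"
      have w: "sgn (wall j c) = sgn (wall j a)" if "j \<in> I" for j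
        unfolding c_def wall_linear using that s by (rule t)
      have "wall i c = S * (t * \<bar>wall i v\<bar>)"
        unfolding c_def wall_linear using a by (simp add: s_def abs_sgn)
      then have "sgn (wall i c) = S" using that t v by (auto simp: sgn_mult)
      moreover have "\<forall>j\<in>I. wall j c \<noteq> 0" using w a by (metis sgn_0_0)
      moreover have "c \<in> V" unfolding c_def by (intro linear_closedD[OF V] a v)
      moreover have "pat c = X" unfolding a(4) pat_def using w by (metis sgn_1_pos)
      ultimately show ?thesis by (auto simp: Y_def)
    qed
    then show "X \<in> Y (-1) \<inter> Y 1" by simp
  qed
  also have "Y (-1) \<union> Y 1 = regions I V"
  proof (intro equalityI subsetI)
    fix X assume "X \<in> regions I V"
    then obtain a where a: "a \<in> V" "\<forall>j\<in>I. wall j a \<noteq> 0" "X = pat a"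
      by (auto simp: regions_def pat_def)
    show "X \<in> Y (-1) \<union> Y 1"
    proof (cases "wall i a = 0")
      case True
      then have "X \<in> regions I {a\<in>V. wall i a = 0}" using a by (auto simp: regions_def pat_def)
      then show ?thesis using \<open>Y (-1) \<inter> Y 1 = _\<close> by blast
    next
      case False
      then show ?thesis using a by (auto simp: Y_def sgn_if)
    qed
  qed (auto simp: Y_def regions_def pat_def)
  finally show ?thesis .
qed

text \<open>On \<open>V\<close> the sign of a wall in \<open>P\<close> is that of some wall in
  \<open>I\<close>, up to the sign of \<open>c\<close>. Hence intersecting a pattern with
  \<open>I\<close> loses nothing.\<close>

lemma card_regions_redundant:
  assumes "\<And>p. p \<in> P \<Longrightarrow> \<exists>j\<in>I. \<exists>c. c \<noteq> 0 \<and> (\<forall>a\<in>V. wall p a = c * wall j a)"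
  shows "card (regions (I \<union> P) V) = card (regions I V)"
proof -
  from assms obtain f c where fc: "\<And>p. p \<in> P \<Longrightarrow> f p \<in> I" "\<And>p. p \<in> P \<Longrightarrow> c p \<noteq> 0"
    "\<And>p a. p \<in> P \<Longrightarrow> a \<in> V \<Longrightarrow> wall p a = c p * wall (f p) a"
    by metis
  have pos: "wall p a > 0 \<longleftrightarrow> (if c p > 0 then f p \<in> X else f p \<notin> X)"
    if "p \<in> P" "a \<in> V" "\<forall>i\<in>I \<union> P. wall i a \<noteq> 0" "X = {i\<in>I \<union> P. wall i a > 0}" for p a X
  proof -
    have "f p \<in> X \<longleftrightarrow> wall (f p) a > 0" "wall (f p) a \<noteq> 0" "c p \<noteq> 0"
      using fc(1,2)[OF that(1)] that by auto
    then show ?thesis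
      unfolding fc(3)[OF that(1,2)] zero_less_mult_iff by (cases "c p > 0") auto
  qed
  have gen: "(\<forall>i\<in>I \<union> P. wall i a \<noteq> 0) \<longleftrightarrow> (\<forall>i\<in>I. wall i a \<noteq> 0)" if "a \<in> V" for a
    using fc that by auto
  have "regions I V = (\<lambda>X. X \<inter> I) ` regions (I \<union> P) V"
    unfolding regions_def image_image using gen by (intro image_cong) auto
  moreover have "inj_on (\<lambda>X. X \<inter> I) (regions (I \<union> P) V)"
  proof (rule inj_onI)
    fix X Y assume "X \<in> regions (I \<union> P) V" "Y \<in> regions (I \<union> P) V" and XY: "X \<inter> I = Y \<inter> I"
    then obtain a b where
      a: "a \<in> V" "\<forall>i\<in>I \<union> P. wall i a \<noteq> 0" "X = {i\<in>I \<union> P. wall i a > 0}" and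
      b: "b \<in> V" "\<forall>i\<in>I \<union> P. wall i b \<noteq> 0" "Y = {i\<in>I \<union> P. wall i b > 0}"
      by (auto simp: regions_def)
    have "p \<in> X \<longleftrightarrow> p \<in> Y" if "p \<in> P" for p
    proof -
      have "f p \<in> X \<longleftrightarrow> f p \<in> Y" using XY fc(1)[OF that] by blast
      moreover have "p \<in> X \<longleftrightarrow> wall p a > 0" "p \<in> Y \<longleftrightarrow> wall p b > 0"
        using that a b by auto
      ultimately show ?thesis using pos[OF that a] pos[OF that b] by simp
    qed
    moreover have "X \<subseteq> I \<union> P" "Y \<subseteq> I \<union> P" using a b by auto
    ultimately show "X = Y" using XY by blast
  qed
  ultimately show ?thesis by (simp add: card_image)
qed

section \<open>The reflection arrangement of type B\<close>

definition new_walls :: "nat \<Rightarrow> (nat \<times> nat \<times> real) set" where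
  "new_walls m = insert (m, 0, 0) ({m} \<times> {1..<m} \<times> {-1, 1})"

text \<open>Grouping the walls by their larger index exhibits the exponents 1, 3, 5, ... of type B
  as the sizes of the groups.\<close>

definition walls :: "nat \<Rightarrow> (nat \<times> nat \<times> real) set" where
  "walls k = (\<Union>m\<in>{1..k}. new_walls m)"

lemma finite_new_walls [simp]: "finite (new_walls m)"
  by (simp add: new_walls_def)

lemma finite_walls [simp]: "finite (walls k)"
  by (simp add: walls_def)

lemma card_new_walls: "card (new_walls (Suc k)) = 2 * k + 1"
proof -
  have "card ({Suc k} \<times> {1..<Suc k} \<times> {-1, 1::real}) = 2 * k"
    by (simp add: card_cartesian_product)
  then show ?thesis by (auto simp: new_walls_def)
qed

lemma walls_Suc: "walls (Suc k) = walls k \<union> new_walls (Suc k)"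
  by (auto simp: walls_def atLeastAtMostSuc_conv)

lemma walls_disjoint: "walls k \<inter> new_walls (Suc k) = {}"
  by (auto simp: walls_def new_walls_def)

lemma walls_iff:
  "(m, j, e) \<in> walls k \<longleftrightarrow> m \<in> {1..k} \<and> (j = 0 \<and> e = 0 \<or> 1 \<le> j \<and> j < m \<and> (e = -1 \<or> e = 1))"
  by (auto simp: walls_def new_walls_def)

text \<open>The new walls are inserted one at a time. On the hyperplane of a new wall, any other new
  wall coincides with an old one, because eliminating coordinate k+1 leaves a form in two old
  coordinates that is again of type B. So each restriction involves the old walls alone; this is the
  supersolvability of the arrangement.\<close>

lemma card_regions_walls_Suc:
  assumes V: "linear_closed V" and nz: "\<And>p. p \<in> new_walls (Suc k) \<Longrightarrow> \<exists>v\<in>V. wall p v \<noteq> 0"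
  shows "card (regions (walls (Suc k)) V) = card (regions (walls k) V) +
    (\<Sum>p\<in>new_walls (Suc k). card (regions (walls k) {a\<in>V. wall p a = 0}))"
proof -
  have "card (regions (walls k \<union> P) V) = card (regions (walls k) V) +
    (\<Sum>p\<in>P. card (regions (walls k) {a\<in>V. wall p a = 0}))"
    if "P \<subseteq> new_walls (Suc k)" for P
    using finite_subset[OF that finite_new_walls] that
  proof (induction P rule: finite_induct)
    case (insert p P)
    obtain v where "v \<in> V" "wall p v \<noteq> 0" using nz insert by blast
    then have "card (regions (insert p (walls k \<union> P)) V) = card (regions (walls k \<union> P) V) +
      card (regions (walls k \<union> P) {a\<in>V. wall p a = 0})"
      using insert walls_disjoint[of k] by (intro card_regions_insert V) auto
    also have "card (regions (walls k \<union> P) {a\<in>V. wall p a = 0}) =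
      card (regions (walls k) {a\<in>V. wall p a = 0})"
    proof (rule card_regions_redundant)
      fix p' assume p': "p' \<in> P"
      have pp: "p' \<noteq> p" "p \<in> new_walls (Suc k)" "p' \<in> new_walls (Suc k)" using insert p' by auto
      obtain j e where p: "p = (Suc k, j, e)" "j = 0 \<and> e = 0 \<or> 1 \<le> j \<and> j \<le> k \<and> (e = -1 \<or> e = 1)"
        using pp(2) by (auto simp: new_walls_def)
      obtain j' e' where p': "p' = (Suc k, j', e')"
        "j' = 0 \<and> e' = 0 \<or> 1 \<le> j' \<and> j' \<le> k \<and> (e' = -1 \<or> e' = 1)"
        using pp(3) by (auto simp: new_walls_def)
      have "\<exists>q\<in>walls k. \<exists>c. c \<noteq> 0 \<and> (\<forall>a. e * a j - e' * a j' = c * wall q a)"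
      proof -
        consider "j = 0" "j' \<ge> 1" | "j \<ge> 1" "j' = 0" | "j \<ge> 1" "j' = j" | "j \<ge> 1" "j' \<ge> 1" "j' < j"
          | "j \<ge> 1" "j' \<ge> 1" "j < j'" 
          using pp(1) p p' by force
        then show ?thesis
        proof cases
          case 1
          then show ?thesis using p p'
            by (intro bexI[of _ "(j', 0, 0)"] exI[of _ "-e'"]) (auto simp: walls_iff)
        next
          case 2
          then show ?thesis using p p'
            by (intro bexI[of _ "(j, 0, 0)"] exI[of _ "e"]) (auto simp: walls_iff)
        next
          case 3
          then have "e' = - e" "e \<noteq> 0" using p p' pp(1) by auto
          then show ?thesis using 3 p p'
            \<comment> \<open>The walls a(k+1) = a(j) and a(k+1) = -a(j) meet where a(j) =
              0.\<close>
            by (intro bexI[of _ "(j, 0, 0)"] exI[of _ "2 * e"]) (auto simp: walls_iff)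
        next
          case 4
          then show ?thesis using p p'
            by (intro bexI[of _ "(j, j', e * e')"] exI[of _ e]) (auto simp: walls_iff)
        next
          case 5
          then show ?thesis using p p'
            by (intro bexI[of _ "(j', j, e * e')"] exI[of _ "-e'"]) (auto simp: walls_iff)
        qed
      qed
      then obtain q c where q: "q \<in> walls k" "c \<noteq> 0" "\<And>a. e * a j - e' * a j' = c * wall q a"
        by blast
      have "\<forall>a\<in>{a \<in> V. wall p a = 0}. wall p' a = c * wall q a"
        using q(3) p p' by auto
      then show "\<exists>j\<in>walls k. \<exists>c. c \<noteq> 0 \<and> (\<forall>a\<in>{a \<in> V. wall p a = 0}. wall p' a = c * wall j a)"
        using q by blast
    qed
    finally show ?case using insert by simp
  qed simp
  from this[of "new_walls (Suc k)"] show ?thesis by (simp add: walls_Suc)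
qed

lemma wall_cong:
  assumes "p \<in> walls k" "\<And>i. i \<in> {1..k} \<Longrightarrow> a i = b i"
  shows "wall p a = wall p b"
proof -
  obtain m j e where "p = (m, j, e)" by (cases p)
  then show ?thesis using assms by (auto simp: walls_iff)
qed

text \<open>The walls read coordinates 1 to k only, so just the projection of \<open>V\<close> to
  these counts; all further values of the total functions are free.\<close>

lemma regions_walls_mono:
  assumes "\<And>a. a \<in> V \<Longrightarrow> \<exists>b\<in>U. \<forall>i\<in>{1..k}. b i = a i"
  shows "regions (walls k) V \<subseteq> regions (walls k) U"
proof
  fix X assume "X \<in> regions (walls k) V"
  then obtain a where a: "a \<in> V" "\<forall>p\<in>walls k. wall p a \<noteq> 0" "X = {p\<in>walls k. wall p a > 0}"
    by (auto simp: regions_def)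
  obtain b where b: "b \<in> U" "\<forall>i\<in>{1..k}. b i = a i" using assms a by blast
  have "wall p a = wall p b" if "p \<in> walls k" for p
    using that b by (intro wall_cong) auto
  with a b show "X \<in> regions (walls k) U"
    unfolding regions_def by (intro image_eqI[of _ _ b]) auto
qed

lemma regions_walls_cong:
  assumes "\<And>a. a \<in> V \<Longrightarrow> \<exists>b\<in>U. \<forall>i\<in>{1..k}. b i = a i"
    and "\<And>a. a \<in> U \<Longrightarrow> \<exists>b\<in>V. \<forall>i\<in>{1..k}. b i = a i"
  shows "regions (walls k) V = regions (walls k) U"
  using assms by (intro equalityI regions_walls_mono)

section \<open>Spaces of linear relations modulo a subspace\<close>

definition relations :: "nat \<Rightarrow> (nat \<Rightarrow> 'v::real_vector) \<Rightarrow> 'v set \<Rightarrow> (nat \<Rightarrow> real) set" where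
  "relations k \<eta> W = {a. (\<Sum>i=1..k. a i *\<^sub>R \<eta> i) \<in> W}"

lemma linear_closed_relations: "subspace W \<Longrightarrow> linear_closed (relations k \<eta> W)"
  unfolding linear_closed_def relations_def
  by (auto simp: scaleR_add_left sum.distrib scaleR_sum_right[symmetric] subspace_add subspace_scale
      simp flip: scaleR_scaleR)

text \<open>Coordinate k+1 is invisible to \<open>walls k\<close>, and letting it vary freely
  amounts to working modulo \<open>\<eta> (Suc k)\<close>. Enlarging \<open>W\<close> keeps the
  ambient space fixed during the induction.\<close>

lemma regions_relations_project:
  fixes \<eta> :: "nat \<Rightarrow> 'v::real_vector"
  assumes "subspace W"
  shows "regions (walls k) (relations (Suc k) \<eta> W) =
    regions (walls k) (relations k \<eta> (span (insert (\<eta> (Suc k)) W)))"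
proof (rule regions_walls_cong)
  fix a assume "a \<in> relations (Suc k) \<eta> W"
  then have "(\<Sum>i=1..k. a i *\<^sub>R \<eta> i) - (- a (Suc k)) *\<^sub>R \<eta> (Suc k) \<in> span W"
    by (auto simp: relations_def intro: span_base)
  then have "a \<in> relations k \<eta> (span (insert (\<eta> (Suc k)) W))"
    unfolding relations_def mem_Collect_eq span_breakdown_eq by blast
  then show "\<exists>b\<in>relations k \<eta> (span (insert (\<eta> (Suc k)) W)). \<forall>i\<in>{1..k}. b i = a i" by blast
next
  fix a assume "a \<in> relations k \<eta> (span (insert (\<eta> (Suc k)) W))"
  then obtain c where "(\<Sum>i=1..k. a i *\<^sub>R \<eta> i) - c *\<^sub>R \<eta> (Suc k) \<in> span W"
    unfolding relations_def mem_Collect_eq span_breakdown_eq by blast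
  then have "a(Suc k := - c) \<in> relations (Suc k) \<eta> W"
    using assms by (simp add: relations_def span_eq_iff[THEN iffD2])
  then show "\<exists>b\<in>relations (Suc k) \<eta> W. \<forall>i\<in>{1..k}. b i = a i"
    by (intro bexI[of _ "a(Suc k := - c)"]) auto
qed

text \<open>On the wall the last vector is absorbed into the one with index \<open>j\<close>. For
  the coordinate hyperplane, \<open>j = 0\<close> and \<open>e = 0\<close>, the update falls outside
  the range of summation and the last vector simply disappears.\<close>

lemma sum_merge:
  fixes \<eta> :: "nat \<Rightarrow> 'v::real_vector"
  assumes "(Suc k, j, e) \<in> new_walls (Suc k)" "a (Suc k) = e * a j"
  shows "(\<Sum>i=1..k. a i *\<^sub>R (\<eta>(j := \<eta> j + e *\<^sub>R \<eta> (Suc k))) i) = (\<Sum>i=1..Suc k. a i *\<^sub>R \<eta> i)"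
proof (cases "j = 0")
  case True
  then have "e = 0" using assms by (simp add: new_walls_def)
  then show ?thesis using assms True by simp
next
  case False
  then have j: "j \<in> {1..k}" using assms by (auto simp: new_walls_def)
  have "(\<Sum>i=1..k. a i *\<^sub>R (\<eta>(j := \<eta> j + e *\<^sub>R \<eta> (Suc k))) i) =
    (\<Sum>i=1..k. a i *\<^sub>R \<eta> i + (if i = j then (e * a j) *\<^sub>R \<eta> (Suc k) else 0))"
    by (intro sum.cong) (auto simp: algebra_simps)
  then show ?thesis using j assms by (simp add: sum.distrib)
qed

lemma regions_relations_restrict:
  fixes \<eta> :: "nat \<Rightarrow> 'v::real_vector"
  assumes p: "(Suc k, j, e) \<in> new_walls (Suc k)"
  shows "regions (walls k) {a\<in>relations (Suc k) \<eta> W. wall (Suc k, j, e) a = 0} =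
    regions (walls k) (relations k (\<eta>(j := \<eta> j + e *\<^sub>R \<eta> (Suc k))) W)"
proof (rule regions_walls_cong)
  fix a assume "a \<in> {a\<in>relations (Suc k) \<eta> W. wall (Suc k, j, e) a = 0}"
  then have "a \<in> relations k (\<eta>(j := \<eta> j + e *\<^sub>R \<eta> (Suc k))) W"
    using sum_merge[OF p, of a \<eta>] unfolding relations_def by (metis (mono_tags, lifting)
      eq_iff_diff_eq_0 mem_Collect_eq wall_simp)
  then show "\<exists>b\<in>relations k (\<eta>(j := \<eta> j + e *\<^sub>R \<eta> (Suc k))) W. \<forall>i\<in>{1..k}. b i = a i" by blast
next
  fix a assume a: "a \<in> relations k (\<eta>(j := \<eta> j + e *\<^sub>R \<eta> (Suc k))) W"
  \<comment> \<open>\<open>relations k\<close> ignores coordinate k+1 of \<open>a\<close>, so it can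
    be reset to lie on the wall.\<close>
  define b where "b = a(Suc k := e * a j)"
  have j: "j \<noteq> Suc k" using p by (auto simp: new_walls_def)
  have eq: "b i = a i" if "i \<in> {1..k}" for i using that by (simp add: b_def)
  have "(\<Sum>i=1..k. a i *\<^sub>R (\<eta>(j := \<eta> j + e *\<^sub>R \<eta> (Suc k))) i) =
    (\<Sum>i=1..k. b i *\<^sub>R (\<eta>(j := \<eta> j + e *\<^sub>R \<eta> (Suc k))) i)"
    by (intro sum.cong) (auto simp: eq)
  also have "\<dots> = (\<Sum>i=1..Suc k. b i *\<^sub>R \<eta> i)"
    using j by (intro sum_merge[OF p]) (simp add: b_def)
  finally have "b \<in> {a\<in>relations (Suc k) \<eta> W. wall (Suc k, j, e) a = 0}"
    using a j by (simp add: relations_def) (simp add: b_def)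
  then show "\<exists>b\<in>{a\<in>relations (Suc k) \<eta> W. wall (Suc k, j, e) a = 0}. \<forall>i\<in>{1..k}. b i = a i"
    using eq by blast
qed

text \<open>Each restriction to a new wall looks like the full space of one dimension less, which
  gives the factor 1 + (2k+1) = 2(k+1).\<close>

lemma card_regions_UNIV: "card (regions (walls k) UNIV) = 2 ^ k * fact k"
proof (induction k)
  case 0
  show ?case by (simp add: walls_def regions_def)
next
  case (Suc k)
  have nz: "\<exists>v\<in>UNIV. wall p v \<noteq> 0" if "p \<in> new_walls (Suc k)" for p
    using that by (intro bexI[of _ "\<lambda>i. if i = Suc k then 1 else 0"]) (auto simp: new_walls_def)
  have restr: "regions (walls k) {a\<in>UNIV. wall p a = 0} = regions (walls k) UNIV"
    if p: "p \<in> new_walls (Suc k)" for p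
  proof (rule regions_walls_cong)
    fix a :: "nat \<Rightarrow> real"
    obtain j e where "p = (Suc k, j, e)" "j \<noteq> Suc k" using p by (auto simp: new_walls_def)
    then show "\<exists>b\<in>{a\<in>UNIV. wall p a = 0}. \<forall>i\<in>{1..k}. b i = a i"
      by (intro bexI[of _ "a(Suc k := e * a j)"]) auto
  qed auto
  have "card (regions (walls (Suc k)) UNIV) = card (regions (walls k) UNIV) +
    (\<Sum>p\<in>new_walls (Suc k). card (regions (walls k) {a\<in>UNIV. wall p a = 0}))"
    using nz by (intro card_regions_walls_Suc) (auto simp: linear_closed_def)
  also have "\<dots> = card (regions (walls k) UNIV) + (2 * k + 1) * card (regions (walls k) UNIV)"
    using restr by (simp add: card_new_walls)
  finally show ?case using Suc.IH by (simp add: algebra_simps)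
qed

text \<open>Dimension count in the quotient by \<open>W\<close>: a vector already in
  \<open>W\<close> is a relation by itself, and any other one can be added to \<open>W\<close>,
  raising its dimension by one.\<close>

lemma dependent_modulo_subspace:
  fixes \<eta> :: "'i \<Rightarrow> 'v::euclidean_space"
  assumes "finite J" "subspace W" "card J + dim W > DIM('v)"
  shows "\<exists>c. (\<exists>i\<in>J. c i \<noteq> 0) \<and> (\<Sum>i\<in>J. c i *\<^sub>R \<eta> i) \<in> W"
  using assms
proof (induction J arbitrary: W rule: finite_induct)
  case empty
  then show ?case using dim_subset_UNIV[of W] by simp
next
  case (insert x J)
  show ?case
  proof (cases "\<eta> x \<in> W")
    case True
    have "(\<Sum>i\<in>insert x J. (if i = x then 1 else 0) *\<^sub>R \<eta> i) = \<eta> x"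
      using insert by (subst sum.insert) (auto intro: sum.neutral)
    then show ?thesis using True by (intro exI[of _ "\<lambda>i. if i = x then 1 else 0"]) auto
  next
    case False
    have "dim (span (insert (\<eta> x) W)) = dim W + 1"
      using False insert.prems by (simp add: dim_insert span_eq_iff[THEN iffD2])
    then obtain c where c: "\<exists>i\<in>J. c i \<noteq> 0" "(\<Sum>i\<in>J. c i *\<^sub>R \<eta> i) \<in> span (insert (\<eta> x) W)"
      using insert.IH[of "span (insert (\<eta> x) W)"] insert.prems insert.hyps by auto
    then obtain t where t: "(\<Sum>i\<in>J. c i *\<^sub>R \<eta> i) - t *\<^sub>R \<eta> x \<in> W"
      using insert.prems by (auto simp: span_breakdown_eq span_eq_iff[THEN iffD2])
    have "(\<Sum>i\<in>insert x J. (c(x := - t)) i *\<^sub>R \<eta> i) = - t *\<^sub>R \<eta> x + (\<Sum>i\<in>J. c i *\<^sub>R \<eta> i)"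
      using insert.hyps by (subst sum.insert) (auto intro!: sum.cong)
    then show ?thesis using t c insert.hyps by (intro exI[of _ "c(x := - t)"]) auto
  qed
qed

text \<open>
  The vectors with at most \<open>d\<close> distinct nonzero absolute values are those in the flats of dimension
  at most \<open>d\<close> of the type \<open>B\<close> arrangement.
\<close>
definition generic :: "nat \<Rightarrow> nat \<Rightarrow> (nat \<Rightarrow> 'v::real_vector) \<Rightarrow> 'v set \<Rightarrow> bool" where
  "generic d k \<eta> W \<longleftrightarrow> (\<forall>a\<in>relations k \<eta> W.
     card ((\<lambda>i. \<bar>a i\<bar>) ` {1..k} - {0}) \<le> d \<longrightarrow> (\<forall>i\<in>{1..k}. a i = 0))"

lemma genericD:
  "generic d k \<eta> W \<Longrightarrow> a \<in> relations k \<eta> W \<Longrightarrow> card ((\<lambda>i. \<bar>a i\<bar>) ` {1..k} - {0}) \<le> d \<Longrightarrow>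
    i \<in> {1..k} \<Longrightarrow> a i = 0"
  unfolding generic_def by blast

text \<open>The coordinate restored for the projected vector adds at most one absolute value, which
  accounts for \<open>Suc d\<close>.\<close>

lemma generic_project:
  fixes \<eta> :: "nat \<Rightarrow> 'v::real_vector"
  assumes "generic (Suc d) (Suc k) \<eta> W" "subspace W"
  shows "generic d k \<eta> (span (insert (\<eta> (Suc k)) W))"
  unfolding generic_def
proof (intro ballI impI)
  fix a i assume a: "a \<in> relations k \<eta> (span (insert (\<eta> (Suc k)) W))"
    and card: "card ((\<lambda>i. \<bar>a i\<bar>) ` {1..k} - {0}) \<le> d" and i: "i \<in> {1..k}"
  obtain c where "(\<Sum>i=1..k. a i *\<^sub>R \<eta> i) - c *\<^sub>R \<eta> (Suc k) \<in> span W"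
    using a unfolding relations_def mem_Collect_eq span_breakdown_eq by blast
  then have b: "a(Suc k := - c) \<in> relations (Suc k) \<eta> W"
    using assms by (simp add: relations_def span_eq_iff[THEN iffD2])
  have "(\<lambda>i. \<bar>(a(Suc k := - c)) i\<bar>) ` {1..Suc k} - {0} \<subseteq>
      insert \<bar>c\<bar> ((\<lambda>i. \<bar>a i\<bar>) ` {1..k} - {0})"
    by auto
  then have "card ((\<lambda>i. \<bar>(a(Suc k := - c)) i\<bar>) ` {1..Suc k} - {0}) \<le>
      card (insert \<bar>c\<bar> ((\<lambda>i. \<bar>a i\<bar>) ` {1..k} - {0}))"
    by (rule card_mono[rotated]) simp
  also have "\<dots> \<le> Suc d" using card card_insert_le_m1 by (simp add: card_insert_if)
  finally have "(a(Suc k := - c)) i = 0"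
    using i by (intro genericD[OF assms(1) b]) auto
  then show "a i = 0" using i by (simp split: if_splits)
qed

text \<open>On a wall the last coordinate is zero or repeats an existing absolute value, so the
  count of values and the codimension stay the same.\<close>

lemma generic_restrict:
  fixes \<eta> :: "nat \<Rightarrow> 'v::real_vector"
  assumes "generic d (Suc k) \<eta> W" and p: "(Suc k, j, e) \<in> new_walls (Suc k)"
  shows "generic d k (\<eta>(j := \<eta> j + e *\<^sub>R \<eta> (Suc k))) W"
  unfolding generic_def
proof (intro ballI impI)
  fix a i assume a: "a \<in> relations k (\<eta>(j := \<eta> j + e *\<^sub>R \<eta> (Suc k))) W"
    and card: "card ((\<lambda>i. \<bar>a i\<bar>) ` {1..k} - {0}) \<le> d" and i: "i \<in> {1..k}"
  define b where "b = a(Suc k := e * a j)"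
  have j: "j \<noteq> Suc k" using p by (auto simp: new_walls_def)
  have eq: "b i = a i" if "i \<in> {1..k}" for i using that by (simp add: b_def)
  have "(\<Sum>i=1..k. a i *\<^sub>R (\<eta>(j := \<eta> j + e *\<^sub>R \<eta> (Suc k))) i) =
    (\<Sum>i=1..k. b i *\<^sub>R (\<eta>(j := \<eta> j + e *\<^sub>R \<eta> (Suc k))) i)"
    by (intro sum.cong) (auto simp: eq)
  also have "\<dots> = (\<Sum>i=1..Suc k. b i *\<^sub>R \<eta> i)"
    using j by (intro sum_merge[OF p]) (simp add: b_def)
  finally have b: "b \<in> relations (Suc k) \<eta> W" using a by (simp add: relations_def)
  have "\<bar>b (Suc k)\<bar> = 0 \<or> \<bar>b (Suc k)\<bar> \<in> (\<lambda>i. \<bar>a i\<bar>) ` {1..k}"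
    using p by (auto simp: b_def new_walls_def abs_mult)
  moreover have "(\<lambda>i. \<bar>b i\<bar>) ` {1..k} = (\<lambda>i. \<bar>a i\<bar>) ` {1..k}"
    by (rule image_cong) (auto simp: eq)
  ultimately have "(\<lambda>i. \<bar>b i\<bar>) ` {1..Suc k} - {0} = (\<lambda>i. \<bar>a i\<bar>) ` {1..k} - {0}"
    by (auto simp: atLeastAtMostSuc_conv)
  then have "b i = 0" using card i by (intro genericD[OF assms(1) b]) auto
  then show "a i = 0" using eq i by simp
qed

text \<open>Provides the transversality required for inserting walls. By dimension there is a
  relation supported on d+1 indices including both coordinates of the wall; genericity forces its
  d+1 absolute values to be distinct and nonzero, so the wall cannot vanish on it.\<close>

lemma generic_wall_nonzero:
  fixes \<eta> :: "nat \<Rightarrow> 'v::euclidean_space"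
  assumes gen: "generic d (Suc k) \<eta> W" and W: "subspace W" "dim W + d = DIM('v)"
    and d: "1 \<le> d" "d \<le> k" and p: "p \<in> new_walls (Suc k)"
  shows "\<exists>v\<in>relations (Suc k) \<eta> W. wall p v \<noteq> 0"
proof -
  obtain j e where p': "p = (Suc k, j, e)"
    "j = 0 \<and> e = 0 \<or> j \<in> {1..k} \<and> (e = -1 \<or> e = 1)"
    using p by (auto simp: new_walls_def)
  \<comment> \<open>A coordinate hyperplane has no second index; 1 serves as a companion.\<close>
  define j' where "j' = (if j = 0 then 1 else j)"
  have j': "j' \<in> {1..k}" using p' d by (auto simp: j'_def)
  have "d - 1 \<le> card ({1..k} - {j'})" using d j' by simp
  then obtain K where K: "K \<subseteq> {1..k} - {j'}" "card K = d - 1"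
    by (rule obtain_subset_with_card_n)
  define J where "J = insert (Suc k) (insert j' K)"
  have finK: "finite K" using K finite_subset by blast
  have "j' \<notin> K" "Suc k \<notin> insert j' K" using K j' by auto
  then have J: "card J = Suc d" "finite J" "J \<subseteq> {1..Suc k}"
    using finK K d j' by (auto simp: J_def)
  obtain c where c: "\<exists>i\<in>J. c i \<noteq> 0" "(\<Sum>i\<in>J. c i *\<^sub>R \<eta> i) \<in> W"
    using dependent_modulo_subspace[of J W \<eta>] J W by auto
  define a where "a = (\<lambda>i. if i \<in> J then c i else 0)"
  have "(\<Sum>i=1..Suc k. a i *\<^sub>R \<eta> i) = (\<Sum>i\<in>J. c i *\<^sub>R \<eta> i)"
    using J by (intro sum.mono_neutral_cong_right) (auto simp: a_def)
  then have a: "a \<in> relations (Suc k) \<eta> W" using c by (simp add: relations_def)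
  have big: "card ((\<lambda>i. \<bar>a i\<bar>) ` {1..Suc k} - {0}) > d"
  proof (rule ccontr)
    assume "\<not> ?thesis"
    then have "a i = 0" if "i \<in> {1..Suc k}" for i
      using genericD[OF gen a _ that] by linarith
    moreover obtain i where "i \<in> J" "c i \<noteq> 0" using c by blast
    ultimately show False using J(3) by (metis a_def subsetD)
  qed
  have sub: "(\<lambda>i. \<bar>a i\<bar>) ` {1..Suc k} - {0} \<subseteq> (\<lambda>i. \<bar>a i\<bar>) ` J - {0}"
    by (auto simp: a_def)
  have "card ((\<lambda>i. \<bar>a i\<bar>) ` {1..Suc k} - {0}) \<le> card ((\<lambda>i. \<bar>a i\<bar>) ` J - {0})"
    using J by (intro card_mono sub) auto
  then have lower: "Suc d \<le> card ((\<lambda>i. \<bar>a i\<bar>) ` J - {0})" using big by simp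
  moreover have "card ((\<lambda>i. \<bar>a i\<bar>) ` J) \<le> Suc d" using J card_image_le by metis
  moreover have "card ((\<lambda>i. \<bar>a i\<bar>) ` J - {0}) \<le> card ((\<lambda>i. \<bar>a i\<bar>) ` J)"
    using J by (intro card_mono) auto
  ultimately have eq: "card ((\<lambda>i. \<bar>a i\<bar>) ` J) = card J"
    "card ((\<lambda>i. \<bar>a i\<bar>) ` J - {0}) = card ((\<lambda>i. \<bar>a i\<bar>) ` J)" using J by auto
  have inj: "inj_on (\<lambda>i. \<bar>a i\<bar>) J" using eq J by (intro eq_card_imp_inj_on)
  have nz: "0 \<notin> (\<lambda>i. \<bar>a i\<bar>) ` J"
    using eq(2) J by (metis Diff_iff Diff_subset card_subset_eq finite_imageI singletonI)
  have mem: "Suc k \<in> J" "j' \<in> J" "j' \<noteq> Suc k" using j' by (auto simp: J_def)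
  have "a (Suc k) \<noteq> 0" using nz mem by force
  moreover have "\<bar>a (Suc k)\<bar> \<noteq> \<bar>a j'\<bar>" using inj mem by (auto dest: inj_onD)
  ultimately have "wall p a \<noteq> 0" using p' by (auto simp: j'_def split: if_splits)
  then show ?thesis using a by blast
qed

text \<open>
  The terms of the recursion come from projecting out the last coordinate (the codimension
  \<open>d\<close> drops by one) and from restricting to the \<open>2 k + 1\<close> walls that involve it.
\<close>
theorem card_regions_relations:
  fixes \<eta> :: "nat \<Rightarrow> 'v::euclidean_space"
  assumes "generic d k \<eta> W" "subspace W" "dim W + d = DIM('v)" "k \<ge> 1"
  shows "int (card (regions (walls k) (relations k \<eta> W))) =
    2 ^ k * fact k - (if d = 0 then 0 else 2 * B_sum k d)"
  using assms
proof (induction k arbitrary: d \<eta> W)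
  case 0
  then show ?case by simp
next
  case (Suc k)
  consider "d = 0" | "Suc k \<le> d" | "1 \<le> d" "d \<le> k" by linarith
  then show ?case
  proof cases
    case 1
    then have "W = UNIV" using Suc.prems by (metis add.right_neutral dim_eq_full span_eq_iff)
    then have "relations (Suc k) \<eta> W = UNIV" by (simp add: relations_def)
    then show ?thesis using 1 by (simp only: card_regions_UNIV) (simp add: algebra_simps)
  next
    case 2
    \<comment> \<open>A vector of length k+1 has at most k+1 \<le> d absolute values, so genericity
      leaves only relations vanishing on 1 to k+1.\<close>
    have zero: "a 1 = 0" if "a \<in> relations (Suc k) \<eta> W" for a
    proof (rule genericD[OF Suc.prems(1) that])
      have "card ((\<lambda>i. \<bar>a i\<bar>) ` {1..Suc k} - {0}) \<le> card ((\<lambda>i. \<bar>a i\<bar>) ` {1..Suc k})"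
        by (intro card_mono) auto
      also have "\<dots> \<le> card {1..Suc k}" by (rule card_image_le) simp
      finally show "card ((\<lambda>i. \<bar>a i\<bar>) ` {1..Suc k} - {0}) \<le> d" using 2 by simp
    qed simp
    have "(1, 0, 0) \<in> walls (Suc k)" by (simp add: walls_iff)
    then have "regions (walls (Suc k)) (relations (Suc k) \<eta> W) = {}"
      unfolding regions_def using zero by force
    then show ?thesis using B_sum_saturated[of "Suc k" d] 2 by simp
  next
    case 3
    let ?W = "span (insert (\<eta> (Suc k)) W)"
    obtain d' where d': "d = Suc d'" using 3 by (cases d) auto
    \<comment> \<open>Otherwise the last unit vector would be a relation with the single nonzero
      absolute value 1.\<close>
    have notin: "\<eta> (Suc k) \<notin> W"
    proof
      assume "\<eta> (Suc k) \<in> W"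
      let ?a = "\<lambda>i. if i = Suc k then 1 else 0 :: real"
      have "(\<Sum>i=1..Suc k. ?a i *\<^sub>R \<eta> i) = \<eta> (Suc k)"
        by (simp add: if_distrib[of "\<lambda>c. c *\<^sub>R _"] cong: if_cong)
      then have a: "?a \<in> relations (Suc k) \<eta> W"
        using \<open>\<eta> (Suc k) \<in> W\<close> by (simp add: relations_def)
      have "card ((\<lambda>i. \<bar>?a i\<bar>) ` {1..Suc k} - {0}) \<le> card {1::real}"
        by (rule card_mono) auto
      then have "?a (Suc k) = 0" using 3 by (intro genericD[OF Suc.prems(1) a]) auto
      then show False by simp
    qed
    have dimW: "dim ?W + d' = DIM('v)"
      using notin Suc.prems d' by (simp add: dim_insert span_eq_iff[THEN iffD2])
    \<comment> \<open>The projected codimension may be zero, which is why the theorem includes that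
      case with its own value.\<close>
    have proj: "int (card (regions (walls k) (relations (Suc k) \<eta> W))) =
        2 ^ k * fact k - (if d' = 0 then 0 else 2 * B_sum k d')"
      unfolding regions_relations_project[OF Suc.prems(2)]
      using 3 dimW Suc.prems d' by (intro Suc.IH generic_project) auto
    have restr: "int (card (regions (walls k) {a\<in>relations (Suc k) \<eta> W. wall p a = 0})) =
        2 ^ k * fact k - 2 * B_sum k d" if p: "p \<in> new_walls (Suc k)" for p
    proof -
      obtain j e where p': "p = (Suc k, j, e)" using p by (auto simp: new_walls_def)
      show ?thesis
        unfolding p' regions_relations_restrict[OF p[unfolded p']]
        using Suc.IH[OF generic_restrict[OF Suc.prems(1) p[unfolded p']]] Suc.prems 3
        by (simp add: fun_upd_def)
    qed
    have "int (card (regions (walls (Suc k)) (relations (Suc k) \<eta> W))) =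
      int (card (regions (walls k) (relations (Suc k) \<eta> W))) +
      (\<Sum>p\<in>new_walls (Suc k).
        int (card (regions (walls k) {a\<in>relations (Suc k) \<eta> W. wall p a = 0})))"
      using card_regions_walls_Suc[OF linear_closed_relations[OF Suc.prems(2)]
          generic_wall_nonzero[OF Suc.prems(1-3) 3]] by simp
    also have "\<dots> = 2 ^ k * fact k - (if d' = 0 then 0 else 2 * B_sum k d') +
        (2 * int k + 1) * (2 ^ k * fact k - 2 * B_sum k d)"
      using proj restr by (simp add: card_new_walls)
    also have "\<dots> = 2 ^ Suc k * fact (Suc k) - 2 * B_sum (Suc k) d"
      using B_sum_Suc[of d k] d' by (simp add: algebra_simps)
    finally show ?thesis using 3 by simp
  qed
qed

section \<open>Signed permutations and convex hulls\<close>

text \<open>Extensional sign functions give every signed permutation a unique representative, as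
  counting requires.\<close>

definition signed_perms :: "nat \<Rightarrow> ((nat \<Rightarrow> nat) \<times> (nat \<Rightarrow> real)) set" where
  "signed_perms k = {\<sigma>. \<sigma> permutes {1..k}} \<times> ({1..k} \<rightarrow>\<^sub>E {-1, 1})"

lemma finite_signed_perms [simp]: "finite (signed_perms k)"
  by (simp add: signed_perms_def finite_permutations finite_PiE)

lemma card_signed_perms: "card (signed_perms k) = 2 ^ k * fact k"
  by (simp add: signed_perms_def card_cartesian_product card_permutations[of _ k] card_PiE numeral_2_eq_2)

lemma signed_permsD:
  assumes "(\<sigma>, \<epsilon>) \<in> signed_perms k"
  shows "\<sigma> permutes {1..k}" "\<And>i. i \<in> {1..k} \<Longrightarrow> \<epsilon> i = -1 \<or> \<epsilon> i = 1"
    "\<And>i. i \<in> {1..k} \<Longrightarrow> \<sigma> i \<in> {1..k}" "\<And>i. i \<in> {1..k} \<Longrightarrow> \<exists>j\<in>{1..k}. i = \<sigma> j"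
proof -
  show \<sigma>: "\<sigma> permutes {1..k}" and "\<And>i. i \<in> {1..k} \<Longrightarrow> \<epsilon> i = -1 \<or> \<epsilon> i = 1"
    using assms by (auto simp: signed_perms_def PiE_def Pi_def)
  show "\<sigma> i \<in> {1..k}" if "i \<in> {1..k}" for i using permutes_in_image[OF \<sigma>] that by simp
  show "\<exists>j\<in>{1..k}. i = \<sigma> j" if "i \<in> {1..k}" for i
    using permutes_image[OF \<sigma>] that by blast
qed

text \<open>The open Weyl chambers of type B. The decreasing order fits summation by parts: tail
  sums of positive coefficients decrease and stay positive.\<close>

definition chamber :: "nat \<Rightarrow> (nat \<Rightarrow> nat) \<times> (nat \<Rightarrow> real) \<Rightarrow> (nat \<Rightarrow> real) set" where
  "chamber k h = (case h of (\<sigma>, \<epsilon>) \<Rightarrow> {a. (\<forall>i\<in>{1..k}. \<epsilon> i * a (\<sigma> i) > 0) \<and>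
     (\<forall>i\<in>{1..k}. \<forall>j\<in>{1..k}. i < j \<longrightarrow> \<epsilon> j * a (\<sigma> j) < \<epsilon> i * a (\<sigma> i))})"

lemma chamber_iff:
  "a \<in> chamber k (\<sigma>, \<epsilon>) \<longleftrightarrow> (\<forall>i\<in>{1..k}. \<epsilon> i * a (\<sigma> i) > 0) \<and>
     (\<forall>i\<in>{1..k}. \<forall>j\<in>{1..k}. i < j \<longrightarrow> \<epsilon> j * a (\<sigma> j) < \<epsilon> i * a (\<sigma> i))"
  by (simp add: chamber_def)

text \<open>In a chamber the order of the absolute values is fixed, so the sign of
  \<open>a m - e * a j\<close> is that of the term whose index comes first under
  \<open>\<sigma>\<close>.\<close>

lemma chamber_sgn_wall:
  assumes h: "(\<sigma>, \<epsilon>) \<in> signed_perms k" and p: "p \<in> walls k"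
  shows "\<exists>s. s \<noteq> 0 \<and> (\<forall>a\<in>chamber k (\<sigma>, \<epsilon>). sgn (wall p a) = s)"
proof -
  note hD = signed_permsD[OF h]
  obtain m j e where pe: "p = (m, j, e)" by (cases p)
  with p have m: "m \<in> {1..k}" and je: "j = 0 \<and> e = 0 \<or> 1 \<le> j \<and> j < m \<and> (e = -1 \<or> e = 1)"
    by (auto simp: walls_iff)
  obtain x where x: "x \<in> {1..k}" "m = \<sigma> x" using hD(4)[OF m] by blast
  have \<epsilon>x: "\<epsilon> x = -1 \<or> \<epsilon> x = 1" using hD(2) x by blast
  show ?thesis
  proof (cases "j = 0")
    case True
    have "sgn (wall p a) = \<epsilon> x" if "a \<in> chamber k (\<sigma>, \<epsilon>)" for a
    proof -
      have "\<epsilon> x * a m > 0" using that x by (auto simp: chamber_iff)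
      then show ?thesis using True je \<epsilon>x pe by (auto simp: sgn_if)
    qed
    then show ?thesis using \<epsilon>x by (intro exI[of _ "\<epsilon> x"]) auto
  next
    case False
    then have j: "j \<in> {1..k}" "j \<noteq> m" and e: "e = -1 \<or> e = 1" using je m by auto
    obtain y where y: "y \<in> {1..k}" "j = \<sigma> y" using hD(4)[OF j(1)] by blast
    have \<epsilon>y: "\<epsilon> y = -1 \<or> \<epsilon> y = 1" using hD(2) y by blast
    have "x \<noteq> y" using j x y by auto
    then consider "x < y" | "y < x" by linarith
    then show ?thesis
    proof cases
      case 1
      have "sgn (wall p a) = \<epsilon> x" if "a \<in> chamber k (\<sigma>, \<epsilon>)" for a
      proof -
        have "\<epsilon> y * a j > 0" "\<epsilon> x * a m > \<epsilon> y * a j"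
          using that x y 1 by (auto simp: chamber_iff)
        then show ?thesis using e \<epsilon>x \<epsilon>y pe by (auto simp: sgn_if)
      qed
      then show ?thesis using \<epsilon>x by (intro exI[of _ "\<epsilon> x"]) auto
    next
      case 2
      have "sgn (wall p a) = - e * \<epsilon> y" if "a \<in> chamber k (\<sigma>, \<epsilon>)" for a
      proof -
        have "\<epsilon> x * a m > 0" "\<epsilon> y * a j > \<epsilon> x * a m"
          using that x y 2 by (auto simp: chamber_iff)
        then show ?thesis using e \<epsilon>x \<epsilon>y pe by (auto simp: sgn_if)
      qed
      then show ?thesis using \<epsilon>y e by (intro exI[of _ "- e * \<epsilon> y"]) auto
    qed
  qed
qed

text \<open>Every inequality defining the chamber is a wall times a sign. Walls list the larger
  index first, hence the two cases.\<close>

lemma chamber_determined_by_walls: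
  assumes h: "(\<sigma>, \<epsilon>) \<in> signed_perms k" and a: "a \<in> chamber k (\<sigma>, \<epsilon>)"
    and ab: "\<And>p. p \<in> walls k \<Longrightarrow> sgn (wall p a) = sgn (wall p b)"
  shows "b \<in> chamber k (\<sigma>, \<epsilon>)"
  unfolding chamber_iff
proof (intro conjI ballI impI)
  note hD = signed_permsD[OF h]
  fix i assume i: "i \<in> {1..k}"
  have "(\<sigma> i, 0, 0) \<in> walls k" using hD(3)[OF i] by (simp add: walls_iff)
  from ab[OF this] have "sgn (\<epsilon> i * b (\<sigma> i)) = sgn (\<epsilon> i * a (\<sigma> i))" by (simp add: sgn_mult)
  moreover have "\<epsilon> i * a (\<sigma> i) > 0" using a i by (simp add: chamber_iff)
  ultimately show "\<epsilon> i * b (\<sigma> i) > 0" by (metis sgn_1_pos)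
  fix j assume j: "j \<in> {1..k}" "i < j"
  have lt: "\<epsilon> j * a (\<sigma> j) < \<epsilon> i * a (\<sigma> i)" using a i j by (auto simp: chamber_iff)
  have ne: "\<sigma> i \<noteq> \<sigma> j" using hD(1) j by (metis nat_neq_iff permutes_def)
  have e: "\<epsilon> i = -1 \<or> \<epsilon> i = 1" "\<epsilon> j = -1 \<or> \<epsilon> j = 1" using hD(2) i j by auto
  have *: "sgn (\<epsilon> i * b (\<sigma> i) - \<epsilon> j * b (\<sigma> j)) = sgn (\<epsilon> i * a (\<sigma> i) - \<epsilon> j * a (\<sigma> j))"
  proof (cases "\<sigma> j < \<sigma> i")
    case True
    have "(\<sigma> i, \<sigma> j, \<epsilon> i * \<epsilon> j) \<in> walls k"
      using hD(3)[OF i] hD(3)[OF j(1)] True e by (auto simp: walls_iff)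
    from ab[OF this] have "sgn (\<epsilon> i) * sgn (b (\<sigma> i) - \<epsilon> i * \<epsilon> j * b (\<sigma> j)) =
        sgn (\<epsilon> i) * sgn (a (\<sigma> i) - \<epsilon> i * \<epsilon> j * a (\<sigma> j))"
      by simp
    then show ?thesis unfolding sgn_mult[symmetric] using e by (auto simp: algebra_simps)
  next
    case False
    then have "(\<sigma> j, \<sigma> i, \<epsilon> i * \<epsilon> j) \<in> walls k"
      using hD(3)[OF i] hD(3)[OF j(1)] ne e by (auto simp: walls_iff)
    from ab[OF this] have "sgn (- \<epsilon> j) * sgn (b (\<sigma> j) - \<epsilon> i * \<epsilon> j * b (\<sigma> i)) =
        sgn (- \<epsilon> j) * sgn (a (\<sigma> j) - \<epsilon> i * \<epsilon> j * a (\<sigma> i))"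
      by simp
    then show ?thesis unfolding sgn_mult[symmetric] using e by (auto simp: algebra_simps)
  qed
  have "sgn (\<epsilon> i * a (\<sigma> i) - \<epsilon> j * a (\<sigma> j)) = 1" using lt by simp
  then have "\<epsilon> i * b (\<sigma> i) - \<epsilon> j * b (\<sigma> j) > 0" using * by (metis sgn_1_pos)
  then show "\<epsilon> j * b (\<sigma> j) < \<epsilon> i * b (\<sigma> i)" by simp
qed

lemma chamber_unique:
  assumes h: "(\<sigma>, \<epsilon>) \<in> signed_perms k" "(\<sigma>', \<epsilon>') \<in> signed_perms k"
    and a: "a \<in> chamber k (\<sigma>, \<epsilon>)" "a \<in> chamber k (\<sigma>', \<epsilon>')"
  shows "\<sigma> = \<sigma>' \<and> \<epsilon> = \<epsilon>'"
proof -
  \<comment> \<open>Sorting by decreasing absolute value recovers the position of each index, and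
    thereby the permutation.\<close>
  define rank where "rank x = card {y\<in>{1..k}. \<bar>a x\<bar> \<le> \<bar>a y\<bar>}" for x
  have rank: "rank (\<sigma> i) = i"
    if h: "(\<sigma>, \<epsilon>) \<in> signed_perms k" and a: "a \<in> chamber k (\<sigma>, \<epsilon>)" and i: "i \<in> {1..k}" for \<sigma> \<epsilon> i
  proof -
    note hD = signed_permsD[OF h]
    have abs: "\<bar>a (\<sigma> i)\<bar> = \<epsilon> i * a (\<sigma> i)" if "i \<in> {1..k}" for i
    proof -
      have "\<epsilon> i * a (\<sigma> i) > 0" using a that by (simp add: chamber_iff)
      then show ?thesis using hD(2)[OF that] by auto
    qed
    have le: "\<bar>a (\<sigma> i)\<bar> \<le> \<bar>a (\<sigma> j)\<bar> \<longleftrightarrow> j \<le> i" if j: "j \<in> {1..k}" for j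
    proof -
      have "i < j \<Longrightarrow> \<bar>a (\<sigma> j)\<bar> < \<bar>a (\<sigma> i)\<bar>" "j < i \<Longrightarrow> \<bar>a (\<sigma> i)\<bar> < \<bar>a (\<sigma> j)\<bar>"
        using a i j unfolding abs[OF j] abs[OF i] chamber_iff by blast+
      then show ?thesis by (cases i j rule: linorder_cases) auto
    qed
    have "{y\<in>{1..k}. \<bar>a (\<sigma> i)\<bar> \<le> \<bar>a y\<bar>} = \<sigma> ` {1..i}"
    proof (intro equalityI subsetI)
      fix y assume y: "y \<in> {y\<in>{1..k}. \<bar>a (\<sigma> i)\<bar> \<le> \<bar>a y\<bar>}"
      then obtain j where j: "j \<in> {1..k}" "y = \<sigma> j" using hD(4)[of y] by blast
      then have "j \<le> i" using le y by simp
      then show "y \<in> \<sigma> ` {1..i}" using j by auto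
    next
      fix y assume "y \<in> \<sigma> ` {1..i}"
      then obtain j where j: "j \<in> {1..i}" "y = \<sigma> j" by blast
      then have "j \<in> {1..k}" using i by auto
      then show "y \<in> {y\<in>{1..k}. \<bar>a (\<sigma> i)\<bar> \<le> \<bar>a y\<bar>}" using le hD(3) j by auto
    qed
    then show ?thesis
      unfolding rank_def using permutes_inj_on[OF hD(1)] by (simp add: card_image)
  qed
  have \<sigma>: "\<sigma> i = \<sigma>' i" if i: "i \<in> {1..k}" for i
  proof -
    obtain j where j: "j \<in> {1..k}" "\<sigma>' i = \<sigma> j"
      using signed_permsD(3)[OF h(2) i] signed_permsD(4)[OF h(1)] by blast
    have "i = j" using rank[OF h(1) a(1) j(1)] rank[OF h(2) a(2) i] j by simp
    then show ?thesis using j by simp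
  qed
  have "\<sigma> i = \<sigma>' i" for i
    using \<sigma> signed_permsD(1)[OF h(1)] signed_permsD(1)[OF h(2)] by (cases "i \<in> {1..k}") (auto simp: permutes_def)
  moreover have "\<epsilon> i = \<epsilon>' i" for i
  proof (cases "i \<in> {1..k}")
    case True
    then have "\<epsilon> i * a (\<sigma> i) > 0" "\<epsilon>' i * a (\<sigma> i) > 0"
      using a \<sigma> by (auto simp: chamber_iff)
    then show ?thesis
      using signed_permsD(2)[OF h(1) True] signed_permsD(2)[OF h(2) True] by auto
  next
    case False
    then show ?thesis using h by (auto simp: signed_perms_def PiE_def extensional_def)
  qed
  ultimately show ?thesis by auto
qed

text \<open>Selection sort: a transposition moves a minimum to the last place. The inequality is
  weak since vectors with ties are sorted later as well.\<close>

lemma sorting_permutation: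
  fixes b :: "nat \<Rightarrow> real"
  shows "\<exists>\<sigma>. \<sigma> permutes {1..k} \<and> (\<forall>i\<in>{1..k}. \<forall>j\<in>{1..k}. i < j \<longrightarrow> b (\<sigma> j) \<le> b (\<sigma> i))"
proof (induction k arbitrary: b)
  case 0
  show ?case by (intro exI[of _ id]) (auto simp: permutes_id)
next
  case (Suc k)
  have "Min (b ` {1..Suc k}) \<in> b ` {1..Suc k}" by (intro Min_in) auto
  then obtain m where m: "m \<in> {1..Suc k}" "b m = Min (b ` {1..Suc k})" by (metis imageE)
  have m_min: "b m \<le> b i" if "i \<in> {1..Suc k}" for i
    unfolding m(2) using that by (intro Min_le) auto
  define \<tau> where "\<tau> = Transposition.transpose m (Suc k)"
  have \<tau>: "\<tau> permutes {1..Suc k}" unfolding \<tau>_def using m by (intro permutes_swap_id) auto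
  obtain \<sigma> where \<sigma>: "\<sigma> permutes {1..k}"
    "\<forall>i\<in>{1..k}. \<forall>j\<in>{1..k}. i < j \<longrightarrow> (b \<circ> \<tau>) (\<sigma> j) \<le> (b \<circ> \<tau>) (\<sigma> i)"
    using Suc.IH[of "b \<circ> \<tau>"] by blast
  have \<sigma>': "\<sigma> permutes {1..Suc k}" using \<sigma>(1) by (rule permutes_subset) auto
  have comp: "\<tau> \<circ> \<sigma> permutes {1..Suc k}" by (rule permutes_compose[OF \<sigma>' \<tau>])
  have "\<sigma> (Suc k) = Suc k" using \<sigma>(1) by (simp add: permutes_def)
  then have last: "(\<tau> \<circ> \<sigma>) (Suc k) = m" by (simp add: \<tau>_def)
  have "b ((\<tau> \<circ> \<sigma>) j) \<le> b ((\<tau> \<circ> \<sigma>) i)" if "i \<in> {1..Suc k}" "j \<in> {1..Suc k}" "i < j" for i j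
  proof (cases "j = Suc k")
    case True
    have "(\<tau> \<circ> \<sigma>) i \<in> {1..Suc k}" using comp that(1) by (simp only: permutes_in_image)
    then show ?thesis using m_min last True by metis
  next
    case False
    then show ?thesis using \<sigma>(2) that by auto
  qed
  then show ?case using comp by blast
qed

lemma chamber_exists:
  assumes "\<forall>p\<in>walls k. wall p a \<noteq> 0"
  shows "\<exists>h\<in>signed_perms k. a \<in> chamber k h"
proof -
  obtain \<sigma> where \<sigma>: "\<sigma> permutes {1..k}"
    "\<forall>i\<in>{1..k}. \<forall>j\<in>{1..k}. i < j \<longrightarrow> \<bar>a (\<sigma> j)\<bar> \<le> \<bar>a (\<sigma> i)\<bar>"
    using sorting_permutation[of k "\<lambda>i. \<bar>a i\<bar>"] by blast
  have in_k: "\<sigma> i \<in> {1..k}" if "i \<in> {1..k}" for i using permutes_in_image[OF \<sigma>(1)] that by simp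
  have nz: "a i \<noteq> 0" if "i \<in> {1..k}" for i
    using assms that by (auto simp: walls_iff dest!: bspec[of _ _ "(i, 0, 0)"])
  have ne1: "\<bar>a i\<bar> \<noteq> \<bar>a j\<bar>" if "i \<in> {1..k}" "j \<in> {1..k}" "j < i" for i j
  proof -
    have "wall (i, j, 1) a \<noteq> 0" "wall (i, j, -1) a \<noteq> 0"
      using that by (auto intro!: assms[rule_format] simp: walls_iff simp del: wall_simp)
    then show ?thesis by (auto simp: abs_if split: if_splits)
  qed
  have ne: "\<bar>a i\<bar> \<noteq> \<bar>a j\<bar>" if "i \<in> {1..k}" "j \<in> {1..k}" "i \<noteq> j" for i j
    using ne1[of i j] ne1[of j i] that by (metis linorder_neqE_nat)
  define \<epsilon> where "\<epsilon> = (\<lambda>i\<in>{1..k}. sgn (a (\<sigma> i)))"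
  have abs: "\<epsilon> i * a (\<sigma> i) = \<bar>a (\<sigma> i)\<bar>" if "i \<in> {1..k}" for i
    using that by (simp add: \<epsilon>_def abs_sgn mult.commute)
  have "(\<sigma>, \<epsilon>) \<in> signed_perms k"
    using \<sigma> nz in_k by (auto simp: signed_perms_def \<epsilon>_def sgn_if)
  moreover have "a \<in> chamber k (\<sigma>, \<epsilon>)"
    unfolding chamber_iff
  proof (intro conjI ballI impI)
    fix i assume i: "i \<in> {1..k}"
    show "\<epsilon> i * a (\<sigma> i) > 0" using nz[OF in_k[OF i]] abs[OF i] by simp
    fix j assume j: "j \<in> {1..k}" "i < j"
    have "\<sigma> i \<noteq> \<sigma> j" using \<sigma>(1) j by (metis nat_neq_iff permutes_def)
    then have "\<bar>a (\<sigma> j)\<bar> \<noteq> \<bar>a (\<sigma> i)\<bar>" using ne in_k i j by metis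
    moreover have "\<bar>a (\<sigma> j)\<bar> \<le> \<bar>a (\<sigma> i)\<bar>" using \<sigma>(2) i j by blast
    ultimately show "\<epsilon> j * a (\<sigma> j) < \<epsilon> i * a (\<sigma> i)" using abs i j by simp
  qed
  ultimately show ?thesis by blast
qed

lemma card_chambers_hit:
  "card {h\<in>signed_perms k. chamber k h \<inter> V \<noteq> {}} = card (regions (walls k) V)"
proof -
  define pat where "pat a = {p\<in>walls k. wall p a > 0}" for a
  \<comment> \<open>A representative in \<open>V\<close> for each chamber that is hit; its pattern
    does not depend on the choice.\<close>
  define f where "f h = (SOME a. a \<in> chamber k h \<inter> V)" for h
  have f: "f h \<in> chamber k h" "f h \<in> V" if "chamber k h \<inter> V \<noteq> {}" for h
    using that someI_ex[of "\<lambda>a. a \<in> chamber k h \<inter> V"] by (auto simp: f_def)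
  have gen: "\<forall>p\<in>walls k. wall p a \<noteq> 0" if "h \<in> signed_perms k" "a \<in> chamber k h" for h a
  proof -
    obtain \<sigma> \<epsilon> where "h = (\<sigma>, \<epsilon>)" by (cases h)
    then show ?thesis using chamber_sgn_wall that by (metis sgn_0)
  qed
  have pat_eq: "pat a = pat b" if "h \<in> signed_perms k" "a \<in> chamber k h" "b \<in> chamber k h" for h a b
  proof -
    obtain \<sigma> \<epsilon> where "h = (\<sigma>, \<epsilon>)" by (cases h)
    then have "sgn (wall p a) = sgn (wall p b)" if "p \<in> walls k" for p
      using chamber_sgn_wall[of \<sigma> \<epsilon> k p] that \<open>h \<in> _\<close> \<open>a \<in> _\<close> \<open>b \<in> _\<close> by metis
    then show ?thesis unfolding pat_def by (metis (no_types, lifting) sgn_1_pos)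
  qed
  have chamber_eq: "h = h'" if h: "h \<in> signed_perms k" "h' \<in> signed_perms k"
    and a: "a \<in> chamber k h" and b: "b \<in> chamber k h'" and eq: "pat a = pat b" for h h' a b
  proof -
    obtain \<sigma> \<epsilon> \<sigma>' \<epsilon>' where h': "h = (\<sigma>, \<epsilon>)" "h' = (\<sigma>', \<epsilon>')" by (cases h, cases h')
    have "sgn (wall p a) = sgn (wall p b)" if p: "p \<in> walls k" for p
    proof -
      have "p \<in> pat a \<longleftrightarrow> wall p a > 0" "p \<in> pat b \<longleftrightarrow> wall p b > 0" using p by (auto simp: pat_def)
      then show ?thesis using gen[OF h(1) a] gen[OF h(2) b] p eq by (auto simp: sgn_if)
    qed
    then have "b \<in> chamber k h" using chamber_determined_by_walls h a h' by blast
    then show ?thesis using chamber_unique h b h' by blast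
  qed
  have "bij_betw (pat \<circ> f) {h\<in>signed_perms k. chamber k h \<inter> V \<noteq> {}} (regions (walls k) V)"
    unfolding bij_betw_def
  proof (intro conjI equalityI subsetI)
    show "inj_on (pat \<circ> f) {h\<in>signed_perms k. chamber k h \<inter> V \<noteq> {}}"
      using chamber_eq f by (intro inj_onI) (metis (mono_tags, lifting) comp_apply mem_Collect_eq)
  next
    fix X assume "X \<in> (pat \<circ> f) ` {h\<in>signed_perms k. chamber k h \<inter> V \<noteq> {}}"
    then obtain h where h: "h \<in> signed_perms k" "chamber k h \<inter> V \<noteq> {}" "X = pat (f h)" by auto
    then show "X \<in> regions (walls k) V"
      unfolding regions_def using f[OF h(2)] gen[OF h(1)] by (auto simp: pat_def)
  next
    fix X assume "X \<in> regions (walls k) V"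
    then obtain a where a: "a \<in> V" "\<forall>p\<in>walls k. wall p a \<noteq> 0" "X = pat a"
      by (auto simp: regions_def pat_def)
    obtain h where h: "h \<in> signed_perms k" "a \<in> chamber k h" using chamber_exists a by blast
    then have ne: "chamber k h \<inter> V \<noteq> {}" using a by blast
    then have "X = pat (f h)" using pat_eq[OF h] f[OF ne] a by simp
    then show "X \<in> (pat \<circ> f) ` {h\<in>signed_perms k. chamber k h \<inter> V \<noteq> {}}" using h ne by auto
  qed
  then show ?thesis by (rule bij_betw_same_card)
qed

section \<open>Relations between the positions of a walk\<close>

definition walk :: "(nat \<Rightarrow> 'v::real_vector) \<Rightarrow> nat \<Rightarrow> 'v" where
  "walk x m = (\<Sum>j=1..m. x j)"

definition signed_permute ::
  "(nat \<Rightarrow> nat) \<times> (nat \<Rightarrow> real) \<Rightarrow> (nat \<Rightarrow> 'v::real_vector) \<Rightarrow> nat \<Rightarrow> 'v" where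
  "signed_permute h x j = snd h j *\<^sub>R x (fst h j)"

lemma summation_by_parts:
  "(\<Sum>m=1..k. (c m - c (Suc m)) *\<^sub>R walk x m) = (\<Sum>j=1..k. c j *\<^sub>R x j) - c (Suc k) *\<^sub>R walk x k"
proof (induction k)
  case (Suc k)
  have "walk x (Suc k) = walk x k + x (Suc k)" by (simp add: walk_def)
  then show ?case using Suc by (simp add: algebra_simps)
qed (simp add: walk_def)

text \<open>Summation by parts turns coefficients on positions into tail sums on steps; undoing
  \<open>\<sigma>\<close> and the signs gives a relation of \<open>\<eta>\<close> itself.\<close>

lemma walk_relation:
  fixes \<eta> :: "nat \<Rightarrow> 'v::real_vector"
  assumes h: "(\<sigma>, \<epsilon>) \<in> signed_perms k"
  obtains a where "\<And>j. j \<in> {1..k} \<Longrightarrow> \<epsilon> j * a (\<sigma> j) = (\<Sum>m=j..k. l m)"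
    "(\<Sum>i=1..k. a i *\<^sub>R \<eta> i) = (\<Sum>m=1..k. l m *\<^sub>R walk (signed_permute (\<sigma>, \<epsilon>) \<eta>) m)"
proof -
  note hD = signed_permsD[OF h]
  define c where "c j = (\<Sum>m=j..k. l m)" for j
  define a where "a = (\<lambda>i. \<epsilon> (inv \<sigma> i) * c (inv \<sigma> i))"
  have a\<sigma>: "a (\<sigma> j) = \<epsilon> j * c j" for j
    by (simp add: a_def permutes_inverses(2)[OF hD(1)])
  have sq: "\<epsilon> j * \<epsilon> j = 1" if "j \<in> {1..k}" for j using hD(2)[OF that] by auto
  have "(\<Sum>i=1..k. a i *\<^sub>R \<eta> i) = (\<Sum>j=1..k. a (\<sigma> j) *\<^sub>R \<eta> (\<sigma> j))"
    using sum.permute[OF hD(1), of "\<lambda>i. a i *\<^sub>R \<eta> i"] by (simp add: o_def)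
  also have "\<dots> = (\<Sum>j=1..k. c j *\<^sub>R signed_permute (\<sigma>, \<epsilon>) \<eta> j)"
    by (simp add: signed_permute_def a\<sigma> mult.commute)
  also have "\<dots> = (\<Sum>m=1..k. (c m - c (Suc m)) *\<^sub>R walk (signed_permute (\<sigma>, \<epsilon>) \<eta>) m)"
    unfolding summation_by_parts by (simp add: c_def)
  also have "\<dots> = (\<Sum>m=1..k. l m *\<^sub>R walk (signed_permute (\<sigma>, \<epsilon>) \<eta>) m)"
    by (intro sum.cong) (auto simp: c_def sum.atLeast_Suc_atMost)
  finally show ?thesis
    using sq by (intro that[of a]) (auto simp: a\<sigma> c_def simp flip: mult.assoc)
qed

text \<open>Tail sums change only at the support of \<open>l\<close>, so they take at most d nonzero
  absolute values. Genericity makes them all zero, and \<open>l\<close> consists of their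
  differences.\<close>

lemma generic_walk_independent:
  fixes \<eta> :: "nat \<Rightarrow> 'v::real_vector"
  assumes gen: "generic d k \<eta> {0}" and h: "(\<sigma>, \<epsilon>) \<in> signed_perms k"
    and zero: "(\<Sum>m=1..k. l m *\<^sub>R walk (signed_permute (\<sigma>, \<epsilon>) \<eta>) m) = 0"
    and card: "card {m\<in>{1..k}. l m \<noteq> 0} \<le> d" and m: "m \<in> {1..k}"
  shows "l m = 0"
proof -
  note hD = signed_permsD[OF h]
  define c where "c j = (\<Sum>m=j..k. l m)" for j
  obtain a where a: "\<And>j. j \<in> {1..k} \<Longrightarrow> \<epsilon> j * a (\<sigma> j) = c j"
    "(\<Sum>i=1..k. a i *\<^sub>R \<eta> i) = (\<Sum>m=1..k. l m *\<^sub>R walk (signed_permute (\<sigma>, \<epsilon>) \<eta>) m)"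
    unfolding c_def using walk_relation[OF h] by blast
  let ?J = "{m\<in>{1..k}. l m \<noteq> 0}"
  have "(\<lambda>i. \<bar>a i\<bar>) ` {1..k} - {0} \<subseteq> (\<lambda>j. \<bar>c j\<bar>) ` ?J"
  proof
    fix x assume "x \<in> (\<lambda>i. \<bar>a i\<bar>) ` {1..k} - {0}"
    then obtain i where i: "i \<in> {1..k}" "x = \<bar>a i\<bar>" "x \<noteq> 0" by auto
    obtain j where j: "j \<in> {1..k}" "i = \<sigma> j" using hD(4)[OF i(1)] by blast
    have xc: "x = \<bar>c j\<bar>" using a(1)[OF j(1)] hD(2)[OF j(1)] i j by auto
    \<comment> \<open>The first support index from \<open>j\<close> on; the tail sums at
      \<open>j\<close> and \<open>n\<close> coincide.\<close>
    define n where "n = (LEAST n. j \<le> n \<and> n \<in> ?J)"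
    have "\<exists>n. j \<le> n \<and> n \<in> ?J"
    proof (rule ccontr)
      assume "\<not> ?thesis"
      then have "c j = 0" unfolding c_def using j by (intro sum.neutral) auto
      then show False using xc i by simp
    qed
    then have n: "j \<le> n \<and> n \<in> ?J" unfolding n_def by (rule LeastI_ex)
    have below: "l m = 0" if "j \<le> m" "m < n" for m
      using not_less_Least[of m "\<lambda>n. j \<le> n \<and> n \<in> ?J", folded n_def] that n j by auto
    have "c j = c n" unfolding c_def
      by (rule sum.mono_neutral_right) (use n below in auto)
    then show "x \<in> (\<lambda>j. \<bar>c j\<bar>) ` ?J" using xc n by auto
  qed
  then have "card ((\<lambda>i. \<bar>a i\<bar>) ` {1..k} - {0}) \<le> card ((\<lambda>j. \<bar>c j\<bar>) ` ?J)"
    by (rule card_mono[rotated]) simp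
  also have "\<dots> \<le> card ?J" by (rule card_image_le) simp
  finally have small: "card ((\<lambda>i. \<bar>a i\<bar>) ` {1..k} - {0}) \<le> d" using card by simp
  have rel: "a \<in> relations k \<eta> {0}" using a(2) zero by (simp add: relations_def)
  have c0: "c j = 0" if "j \<in> {1..Suc k}" for j
  proof (cases "j = Suc k")
    case False
    then have j: "j \<in> {1..k}" using that by auto
    show ?thesis using genericD[OF gen rel small hD(3)[OF j]] a(1)[OF j] by simp
  qed (simp add: c_def)
  have "l m = c m - c (Suc m)" using m by (simp add: c_def sum.atLeast_Suc_atMost)
  then show ?thesis using c0[of m] c0[of "Suc m"] m by simp
qed

lemma zero_in_convex_hull_image:
  fixes S :: "'i \<Rightarrow> 'v::real_vector"
  assumes "finite I"
  shows "0 \<in> convex hull (S ` I) \<longleftrightarrow>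
    (\<exists>l. (\<forall>i\<in>I. l i \<ge> 0) \<and> (\<exists>i\<in>I. l i > 0) \<and> (\<Sum>i\<in>I. l i *\<^sub>R S i) = 0)"
proof
  assume "0 \<in> convex hull (S ` I)"
  then obtain u where u: "\<forall>x\<in>S ` I. 0 \<le> u x" "sum u (S ` I) = (1::real)"
    "(\<Sum>x\<in>S ` I. u x *\<^sub>R x) = 0"
    using assms by (auto simp: convex_hull_finite)
  \<comment> \<open>Points may repeat. Weights on points are moved to one chosen index per
    point.\<close>
  obtain J where J: "J \<subseteq> I" "inj_on S J" "S ` I = S ` J"
    by (metis order_refl subset_image_inj)
  define l where "l i = (if i \<in> J then u (S i) else 0)" for i
  have "(\<Sum>i\<in>I. l i) = (\<Sum>i\<in>J. u (S i))"
    using J assms by (intro sum.mono_neutral_cong_right) (auto simp: l_def)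
  then have "(\<Sum>i\<in>I. l i) = 1" using u J by (simp add: sum.reindex)
  then have "\<exists>i\<in>I. l i > 0" by (metis not_le sum_nonpos zero_less_one)
  moreover have "(\<Sum>i\<in>I. l i *\<^sub>R S i) = (\<Sum>i\<in>J. u (S i) *\<^sub>R S i)"
    using J assms by (intro sum.mono_neutral_cong_right) (auto simp: l_def)
  moreover have "\<dots> = 0" using u J by (simp add: sum.reindex)
  ultimately show "\<exists>l. (\<forall>i\<in>I. l i \<ge> 0) \<and> (\<exists>i\<in>I. l i > 0) \<and> (\<Sum>i\<in>I. l i *\<^sub>R S i) = 0"
    using u J by (intro exI[of _ l]) (auto simp: l_def)
next
  assume "\<exists>l. (\<forall>i\<in>I. l i \<ge> 0) \<and> (\<exists>i\<in>I. l i > 0) \<and> (\<Sum>i\<in>I. l i *\<^sub>R S i) = 0"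
  then obtain l where l: "\<forall>i\<in>I. l i \<ge> 0" "\<exists>i\<in>I. l i > 0" "(\<Sum>i\<in>I. l i *\<^sub>R S i) = 0" by blast
  define t where "t = sum l I"
  have t: "t > 0" unfolding t_def using l assms by (metis sum_pos2)
  have "(\<Sum>i\<in>I. (l i / t) *\<^sub>R S i) \<in> convex hull (S ` I)"
    using l t assms by (intro convex_sum) (auto simp: t_def hull_inc simp flip: sum_divide_distrib)
  also have "(\<Sum>i\<in>I. (l i / t) *\<^sub>R S i) = (1 / t) *\<^sub>R (\<Sum>i\<in>I. l i *\<^sub>R S i)"
    by (simp add: scaleR_sum_right)
  finally show "0 \<in> convex hull (S ` I)" using l by simp
qed

text \<open>
  The support of a nonnegative relation has more than \<open>DIM('v)\<close> elements, and \<open>DIM('v)\<close> of these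
  partial sums span, so the relation can be perturbed to a strictly positive one.
\<close>
lemma positive_walk_relation:
  fixes \<eta> :: "nat \<Rightarrow> 'v::euclidean_space"
  assumes gen: "generic DIM('v) k \<eta> {0}" and h: "(\<sigma>, \<epsilon>) \<in> signed_perms k"
  defines "S \<equiv> walk (signed_permute (\<sigma>, \<epsilon>) \<eta>)"
  assumes zero: "0 \<in> convex hull (S ` {1..k})"
  shows "\<exists>l. (\<forall>m\<in>{1..k}. l m > 0) \<and> (\<Sum>m=1..k. l m *\<^sub>R S m) = 0"
proof -
  note indep = generic_walk_independent[OF gen h, folded S_def]
  obtain l where l: "\<forall>m\<in>{1..k}. l m \<ge> 0" "\<exists>m\<in>{1..k}. l m > 0" "(\<Sum>m=1..k. l m *\<^sub>R S m) = 0"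
    using zero zero_in_convex_hull_image[of "{1..k}" S] by auto
  let ?J = "{m\<in>{1..k}. l m \<noteq> 0}"
  have "DIM('v) \<le> card ?J"
    using indep[OF l(3)] l(2) by (metis le_cases less_irrefl)
  then obtain K where K: "K \<subseteq> ?J" "card K = DIM('v)"
    by (rule obtain_subset_with_card_n)
  have finK: "finite K" using K finite_subset by fastforce
  \<comment> \<open>Positions start at 1, so slot 0 is free for the sum of the points of weight
    zero. Together with the points of \<open>K\<close> this makes d+1 vectors, hence a
    dependence.\<close>
  define T where "T = S(0 := \<Sum>m\<in>{1..k} - ?J. S m)"
  have K0: "0 \<notin> K" using K by auto
  obtain c where c: "\<exists>i\<in>insert 0 K. c i \<noteq> 0" "(\<Sum>i\<in>insert 0 K. c i *\<^sub>R T i) \<in> {0}"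
    using dependent_modulo_subspace[of "insert 0 K" "{0}" T] finK K K0 by (auto simp: subspace_single_0)
  have "(\<Sum>m\<in>K. c m *\<^sub>R T m) = (\<Sum>m\<in>K. c m *\<^sub>R S m)"
    using K0 by (intro sum.cong) (auto simp: T_def)
  then have c_sum: "c 0 *\<^sub>R (\<Sum>m\<in>{1..k} - ?J. S m) + (\<Sum>m\<in>K. c m *\<^sub>R S m) = 0"
    using c(2) K0 finK by (simp add: T_def)
  have "c 0 \<noteq> 0"
  proof
    assume c0: "c 0 = 0"
    define b where "b m = (if m \<in> K then c m else 0)" for m
    have "(\<Sum>m=1..k. b m *\<^sub>R S m) = (\<Sum>m\<in>K. c m *\<^sub>R S m)"
      using K by (intro sum.mono_neutral_cong_right) (auto simp: b_def)
    then have b: "(\<Sum>m=1..k. b m *\<^sub>R S m) = 0" using c_sum c0 by simp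
    have "card {m\<in>{1..k}. b m \<noteq> 0} \<le> card K"
      by (rule card_mono[OF finK]) (auto simp: b_def split: if_splits)
    then have "b m = 0" if "m \<in> {1..k}" for m using indep[OF b _ that] K by simp
    moreover obtain m where m: "m \<in> K" "c m \<noteq> 0" using c(1) c0 by auto
    moreover have "m \<in> {1..k}" using m K by auto
    ultimately show False by (metis b_def)
  qed
  \<comment> \<open>A relation with coefficient 1 at each point of weight zero; a small multiple
    makes those weights positive without spoiling the others.\<close>
  define b where "b m = (if m \<in> ?J then (if m \<in> K then c m / c 0 else 0) else 1)" for m
  have "(\<Sum>m=1..k. b m *\<^sub>R S m) = (\<Sum>m\<in>{1..k} - ?J. b m *\<^sub>R S m) + (\<Sum>m\<in>?J. b m *\<^sub>R S m)"
    by (rule sum.subset_diff) auto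
  also have "(\<Sum>m\<in>{1..k} - ?J. b m *\<^sub>R S m) = (\<Sum>m\<in>{1..k} - ?J. S m)"
    by (intro sum.cong) (auto simp: b_def)
  also have "(\<Sum>m\<in>?J. b m *\<^sub>R S m) = (\<Sum>m\<in>K. (c m / c 0) *\<^sub>R S m)"
    using K by (intro sum.mono_neutral_cong_right) (auto simp: b_def)
  also have "\<dots> = (1 / c 0) *\<^sub>R (\<Sum>m\<in>K. c m *\<^sub>R S m)" by (simp add: scaleR_sum_right)
  also have "(\<Sum>m\<in>{1..k} - ?J. S m) + \<dots> =
      (1 / c 0) *\<^sub>R (c 0 *\<^sub>R (\<Sum>m\<in>{1..k} - ?J. S m) + (\<Sum>m\<in>K. c m *\<^sub>R S m))"
    using \<open>c 0 \<noteq> 0\<close> by (simp add: scaleR_add_right)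
  finally have b: "(\<Sum>m=1..k. b m *\<^sub>R S m) = 0" using c_sum by simp
  obtain t where t: "t > 0" "\<And>i s. i \<in> ?J \<Longrightarrow> \<bar>s\<bar> \<le> t \<Longrightarrow> sgn (l i + s * b i) = sgn (l i)"
    by (rule perturb[of ?J l b]) auto
  have "l m + t * b m > 0" if m: "m \<in> {1..k}" for m
  proof (cases "m \<in> ?J")
    case True
    then have "l m > 0" using l(1) by (force simp: less_le)
    moreover have "sgn (l m + t * b m) = sgn (l m)" using t True by simp
    ultimately show ?thesis by (metis sgn_1_pos)
  next
    case False
    then have "l m = 0" using m by auto
    moreover have "b m = 1" using False by (simp only: b_def if_False)
    ultimately show ?thesis using t by simp
  qed
  moreover have "(\<Sum>m=1..k. (l m + t * b m) *\<^sub>R S m) = 0"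
  proof -
    have "(\<Sum>m=1..k. (l m + t * b m) *\<^sub>R S m) =
        (\<Sum>m=1..k. l m *\<^sub>R S m) + t *\<^sub>R (\<Sum>m=1..k. b m *\<^sub>R S m)"
      by (simp add: scaleR_add_left sum.distrib scaleR_sum_right)
    then show ?thesis using l b by simp
  qed
  ultimately show ?thesis by (intro exI[of _ "\<lambda>m. l m + t * b m"]) auto
qed

text \<open>Strictly positive weights and points of the open chamber determine each other through
  tail sums and differences.\<close>

lemma zero_in_hull_iff_chamber_hit:
  fixes \<eta> :: "nat \<Rightarrow> 'v::euclidean_space"
  assumes gen: "generic DIM('v) k \<eta> {0}" and h: "(\<sigma>, \<epsilon>) \<in> signed_perms k" and k: "k \<ge> 1"
  shows "0 \<in> convex hull (walk (signed_permute (\<sigma>, \<epsilon>) \<eta>) ` {1..k}) \<longleftrightarrow>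
    chamber k (\<sigma>, \<epsilon>) \<inter> relations k \<eta> {0} \<noteq> {}"
proof
  let ?S = "walk (signed_permute (\<sigma>, \<epsilon>) \<eta>)"
  note hD = signed_permsD[OF h]
  assume "0 \<in> convex hull (?S ` {1..k})"
  then obtain l where l: "\<forall>m\<in>{1..k}. l m > 0" "(\<Sum>m=1..k. l m *\<^sub>R ?S m) = 0"
    using positive_walk_relation[OF gen h] by blast
  obtain a where a: "\<And>j. j \<in> {1..k} \<Longrightarrow> \<epsilon> j * a (\<sigma> j) = (\<Sum>m=j..k. l m)"
    "(\<Sum>i=1..k. a i *\<^sub>R \<eta> i) = (\<Sum>m=1..k. l m *\<^sub>R ?S m)"
    using walk_relation[OF h] by blast
  have "a \<in> chamber k (\<sigma>, \<epsilon>)"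
    unfolding chamber_iff
  proof (intro conjI ballI impI)
    fix i assume i: "i \<in> {1..k}"
    show "\<epsilon> i * a (\<sigma> i) > 0" unfolding a(1)[OF i] using i l by (intro sum_pos) auto
    fix j assume j: "j \<in> {1..k}" "i < j"
    show "\<epsilon> j * a (\<sigma> j) < \<epsilon> i * a (\<sigma> i)" unfolding a(1)[OF i] a(1)[OF j(1)]
      using i j l by (intro sum_strict_mono2[of _ _ i]) (auto intro: less_imp_le)
  qed
  moreover have "a \<in> relations k \<eta> {0}" using a(2) l(2) by (simp add: relations_def)
  ultimately show "chamber k (\<sigma>, \<epsilon>) \<inter> relations k \<eta> {0} \<noteq> {}" by blast
next
  let ?S = "walk (signed_permute (\<sigma>, \<epsilon>) \<eta>)"
  note hD = signed_permsD[OF h]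
  assume "chamber k (\<sigma>, \<epsilon>) \<inter> relations k \<eta> {0} \<noteq> {}"
  then obtain a where a: "a \<in> chamber k (\<sigma>, \<epsilon>)" "(\<Sum>i=1..k. a i *\<^sub>R \<eta> i) = 0"
    by (auto simp: relations_def)
  \<comment> \<open>The value 0 beyond \<open>k\<close> makes the last difference equal to the
    smallest chamber coordinate, which is positive.\<close>
  define c where "c j = (if j \<le> k then \<epsilon> j * a (\<sigma> j) else 0)" for j
  have "(\<Sum>m=1..k. (c m - c (Suc m)) *\<^sub>R ?S m) = (\<Sum>j=1..k. c j *\<^sub>R signed_permute (\<sigma>, \<epsilon>) \<eta> j)"
    unfolding summation_by_parts by (simp add: c_def)
  also have "\<dots> = (\<Sum>j=1..k. a (\<sigma> j) *\<^sub>R \<eta> (\<sigma> j))"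
  proof (rule sum.cong)
    fix j assume "j \<in> {1..k}"
    then show "c j *\<^sub>R signed_permute (\<sigma>, \<epsilon>) \<eta> j = a (\<sigma> j) *\<^sub>R \<eta> (\<sigma> j)"
      using hD(2)[of j] by (auto simp: c_def signed_permute_def)
  qed simp
  also have "\<dots> = 0"
    using sum.permute[OF hD(1), of "\<lambda>i. a i *\<^sub>R \<eta> i"] a(2) by (simp add: o_def)
  finally have zero: "(\<Sum>m=1..k. (c m - c (Suc m)) *\<^sub>R ?S m) = 0" .
  have pos: "c m - c (Suc m) > 0" if "m \<in> {1..k}" for m
    using a(1) that by (cases "m = k") (auto simp: chamber_iff c_def)
  then show "0 \<in> convex hull (?S ` {1..k})"
    unfolding zero_in_convex_hull_image[OF finite_atLeastAtMost] using zero k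
    by (intro exI[of _ "\<lambda>m. c m - c (Suc m)"] conjI ballI bexI[of _ 1]) (auto intro: less_imp_le)
qed

theorem card_signed_perms_hull_avoids_zero:
  fixes \<eta> :: "nat \<Rightarrow> 'v::euclidean_space"
  assumes gen: "generic DIM('v) k \<eta> {0}" and k: "k \<ge> 1"
  shows "int (card {h\<in>signed_perms k. 0 \<notin> convex hull (walk (signed_permute h \<eta>) ` {1..k})}) =
    2 * B_sum k DIM('v)"
proof -
  let ?A = "{h\<in>signed_perms k. 0 \<in> convex hull (walk (signed_permute h \<eta>) ` {1..k})}"
  have "?A = {h\<in>signed_perms k. chamber k h \<inter> relations k \<eta> {0} \<noteq> {}}"
    using zero_in_hull_iff_chamber_hit[OF gen _ k] by auto
  then have "int (card ?A) = 2 ^ k * fact k - 2 * B_sum k DIM('v)"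
    using card_regions_relations[OF gen _ _ k] by (simp add: card_chambers_hit subspace_single_0)
  moreover have "{h\<in>signed_perms k. 0 \<notin> convex hull (walk (signed_permute h \<eta>) ` {1..k})} =
      signed_perms k - ?A"
    by auto
  moreover have "card ?A \<le> card (signed_perms k)" by (intro card_mono) auto
  ultimately show ?thesis
    by (simp add: card_Diff_subset card_signed_perms of_nat_diff)
qed

section \<open>Blocks\<close>

definition block_end :: "(nat \<Rightarrow> nat) \<Rightarrow> nat \<Rightarrow> nat" where
  "block_end l j = (\<Sum>i=1..j. l i)"

definition block :: "(nat \<Rightarrow> nat) \<Rightarrow> nat \<Rightarrow> nat set" where
  "block l j = {block_end l (j - 1)<..block_end l j}"

definition block_sum :: "(nat \<Rightarrow> nat) \<Rightarrow> (nat \<Rightarrow> 'v::real_vector) \<Rightarrow> nat \<Rightarrow> 'v" where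
  "block_sum l x j = (\<Sum>i\<in>block l j. x i)"

text \<open>The gap vectors of the k-element index sets, with the leftover after the last index not
  recorded.\<close>

definition block_sizes :: "nat \<Rightarrow> nat \<Rightarrow> (nat \<Rightarrow> nat) set" where
  "block_sizes n k = {l \<in> {1..k} \<rightarrow>\<^sub>E {1..n}. block_end l k \<le> n}"

lemma block_end_0 [simp]: "block_end l 0 = 0"
  by (simp add: block_end_def)

lemma block_end_Suc [simp]: "block_end l (Suc j) = block_end l j + l (Suc j)"
  by (simp add: block_end_def)

lemma block_end_mono: "i \<le> j \<Longrightarrow> block_end l i \<le> block_end l j"
  by (rule lift_Suc_mono_le) auto

lemma finite_block_sizes [simp]: "finite (block_sizes n k)"
  unfolding block_sizes_def by (rule finite_subset[of _ "{1..k} \<rightarrow>\<^sub>E {1..n}"]) (auto intro: finite_PiE)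

lemma card_block: "j \<ge> 1 \<Longrightarrow> card (block l j) = l j"
  by (cases j) (simp_all add: block_def)

lemma finite_block [simp]: "finite (block l j)"
  by (simp add: block_def)

lemma UN_block: "(\<Union>j\<in>{1..k}. block l j) = {1..block_end l k}"
proof (induction k)
  case (Suc k)
  have "(\<Union>j\<in>{1..Suc k}. block l j) = {1..block_end l k} \<union> block l (Suc k)"
    using Suc by (auto simp: atLeastAtMostSuc_conv)
  then show ?case by (auto simp: block_def)
qed simp

lemma block_unique:
  assumes "i \<in> block l j" "i \<in> block l j'"
  shows "j = j'"
proof -
  have False if "i \<in> block l j" "i \<in> block l j'" "j < j'" for j j'
  proof -
    have "j \<le> j' - 1" using that by simp
    from block_end_mono[OF this, of l] show False using that by (simp add: block_def)
  qed
  then show ?thesis using assms by (metis linorder_neqE_nat)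
qed

lemma block_subset:
  assumes "l \<in> block_sizes n k" "j \<in> {1..k}"
  shows "block l j \<subseteq> {1..n}"
proof -
  have "block l j \<subseteq> {1..block_end l k}" using assms(2) UN_block[of l k] by blast
  also have "\<dots> \<subseteq> {1..n}" using assms(1) by (auto simp: block_sizes_def)
  finally show ?thesis .
qed

text \<open>Makes the selected positions of a walk the consecutive positions of the walk of block
  sums.\<close>

lemma walk_block_sum: "walk (block_sum l x) m = walk x (block_end l m)"
proof (induction m)
  case (Suc m)
  have "walk x (block_end l (Suc m)) = (\<Sum>i\<in>{1..block_end l m} \<union> block l (Suc m). x i)"
    unfolding walk_def by (rule sum.cong) (auto simp: block_def)
  also have "\<dots> = walk x (block_end l m) + block_sum l x (Suc m)"
    unfolding walk_def block_sum_def by (rule sum.union_disjoint) (auto simp: block_def)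
  finally show ?case using Suc by (simp add: walk_def)
qed (simp add: walk_def)

lemma block_end_strict:
  assumes "l \<in> block_sizes n k" "i < j" "j \<le> k"
  shows "block_end l i < block_end l j"
proof -
  obtain j' where j: "j = Suc j'" using assms by (cases j) auto
  then have "l j \<ge> 1" using assms by (auto simp: block_sizes_def PiE_def Pi_def)
  then show ?thesis using block_end_mono[of i j' l] assms j by simp
qed

lemma block_sizes_permute:
  assumes "l \<in> block_sizes n k" "\<sigma> permutes {1..k}"
  shows "l \<circ> \<sigma> \<in> block_sizes n k"
proof -
  have "block_end (l \<circ> \<sigma>) k = block_end l k"
    using sum.permute[OF assms(2), of l] by (simp add: block_end_def o_def)
  moreover have "\<sigma> i \<in> {1..k} \<longleftrightarrow> i \<in> {1..k}" for i
    using permutes_in_image[OF assms(2)] by simp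
  moreover have "\<sigma> i = i" if "i \<notin> {1..k}" for i using assms(2) that by (auto simp: permutes_def)
  ultimately show ?thesis using assms(1)
    unfolding block_sizes_def PiE_def Pi_def extensional_def
    by (auto simp del: atLeastAtMost_iff)
qed

lemma sum_block_sizes_permute:
  assumes "\<sigma> permutes {1..k}"
  shows "(\<Sum>l\<in>block_sizes n k. F (l \<circ> \<sigma>)) = (\<Sum>l\<in>block_sizes n k. F l)"
  by (rule sum.reindex_bij_witness[of _ "\<lambda>l. l \<circ> inv \<sigma>" "\<lambda>l. l \<circ> \<sigma>"])
    (auto simp: comp_assoc permutes_inv_o[OF assms]
      intro: block_sizes_permute[OF _ assms] block_sizes_permute[OF _ permutes_inv[OF assms]])

lemma block_end_enum:
  assumes "l \<in> block_sizes n k" "m \<in> {1..k}"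
  shows "card {y \<in> block_end l ` {1..k}. y \<le> block_end l m} = m"
proof -
  have le: "block_end l i \<le> block_end l m \<longleftrightarrow> i \<le> m" if "i \<in> {1..k}" for i
    using block_end_strict[OF assms(1), of m i] block_end_mono[of i m l] that by fastforce
  have "{y \<in> block_end l ` {1..k}. y \<le> block_end l m} = block_end l ` {1..m}"
    using le assms(2) by auto
  moreover have "inj_on (block_end l) {1..m}"
    using block_end_strict[OF assms(1)] assms(2)
    by (intro linorder_inj_onI) (auto simp: less_imp_neq)
  ultimately show ?thesis by (simp add: card_image)
qed

lemma bij_betw_block_ends:
  "bij_betw (\<lambda>l. block_end l ` {1..k}) (block_sizes n k) {I. I \<subseteq> {1..n} \<and> card I = k}"
  unfolding bij_betw_def
proof (intro conjI inj_onI equalityI subsetI)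
  fix l l' assume l: "l \<in> block_sizes n k" "l' \<in> block_sizes n k"
    and eq: "block_end l ` {1..k} = block_end l' ` {1..k}"
  have ends: "block_end l m = block_end l' m" if m: "m \<le> k" for m
  proof (cases "m = 0")
    case False
    then have m: "m \<in> {1..k}" using m by simp
    obtain m' where m': "m' \<in> {1..k}" "block_end l m = block_end l' m'" using eq m by blast
    have "m = m'" using block_end_enum[OF l(1) m] block_end_enum[OF l(2) m'(1)] eq m' by simp
    then show ?thesis using m' by simp
  qed simp
  show "l = l'"
  proof
    fix j show "l j = l' j"
    proof (cases "j \<in> {1..k}")
      case True
      then obtain i where "j = Suc i" by (cases j) auto
      then show ?thesis using ends[of i] ends[of j] True by simp
    next
      case False
      then show ?thesis using l by (auto simp: block_sizes_def PiE_def extensional_def)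
    qed
  qed
next
  fix I assume "I \<in> (\<lambda>l. block_end l ` {1..k}) ` block_sizes n k"
  then obtain l where l: "l \<in> block_sizes n k" "I = block_end l ` {1..k}" by blast
  have "block_end l m \<in> {1..n}" if "m \<in> {1..k}" for m
    using block_end_strict[OF l(1), of 0 m] block_end_mono[of m k l] that l(1)
    by (auto simp: block_sizes_def)
  moreover have "inj_on (block_end l) {1..k}"
    using block_end_strict[OF l(1)] by (intro linorder_inj_onI) (auto simp: less_imp_neq)
  ultimately show "I \<in> {I. I \<subseteq> {1..n} \<and> card I = k}" using l(2) by (auto simp: card_image)
next
  fix I assume "I \<in> {I. I \<subseteq> {1..n} \<and> card I = k}"
  then have I: "I \<subseteq> {1..n}" "card I = k" "finite I" by (auto intro: finite_subset)
  define xs where "xs = sorted_list_of_set I"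
  have xs: "length xs = k" "set xs = I" "sorted_wrt (<) xs" using I by (auto simp: xs_def)
  \<comment> \<open>The increasing enumeration, with 0 put in front so that the first gap is the
    first index.\<close>
  define e where "e j = (if j = 0 then 0 else xs ! (j - 1))" for j
  have e_in: "e j \<in> {1..n}" if "j \<in> {1..k}" for j
  proof -
    have "xs ! (j - 1) \<in> I" using that xs nth_mem[of "j - 1" xs] by auto
    then show ?thesis using that I by (auto simp: e_def)
  qed
  have e_less: "e j < e (Suc j)" if "Suc j \<le> k" for j
  proof (cases "j = 0")
    case True
    then show ?thesis using e_in[of 1] that by (simp add: e_def)
  next
    case False
    then show ?thesis using that xs sorted_wrt_nth_less[of "(<)" xs "j - 1" j] by (simp add: e_def)
  qed
  define l where "l = (\<lambda>j\<in>{1..k}. e j - e (j - 1))"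
  have ends: "block_end l m = e m" if "m \<le> k" for m
    using that
  proof (induction m)
    case (Suc m)
    then show ?case using e_less[of m] by (simp add: l_def)
  qed (simp add: e_def)
  have "l j \<in> {1..n}" if "j \<in> {1..k}" for j
    using that e_in[OF that] e_less[of "j - 1"] by (auto simp: l_def)
  moreover have "block_end l k \<le> n"
    using ends[of k] e_in[of k] by (cases "k = 0") auto
  ultimately have "l \<in> block_sizes n k" by (auto simp: block_sizes_def l_def)
  moreover have "I = block_end l ` {1..k}"
  proof -
    have "I = (\<lambda>i. xs ! i) ` {..<k}" using xs by (auto simp: set_conv_nth)
    also have "\<dots> = (\<lambda>i. e (Suc i)) ` {..<k}" by (simp add: e_def)
    also have "\<dots> = e ` {1..k}" unfolding image_image[symmetric, of e Suc]
      by (simp add: image_Suc_lessThan)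
    also have "\<dots> = block_end l ` {1..k}" using ends by (intro image_cong) auto
    finally show ?thesis .
  qed
  ultimately show "I \<in> (\<lambda>l. block_end l ` {1..k}) ` block_sizes n k" by blast
qed

text \<open>A relation of the block sums lifts to one of the steps that is constant on blocks and
  zero past the last one, so no nonzero absolute value is added.\<close>

lemma generic_block_sum:
  fixes x :: "nat \<Rightarrow> 'v::real_vector"
  assumes gen: "generic d n x {0}" and l: "l \<in> block_sizes n k"
  shows "generic d k (block_sum l x) {0}"
  unfolding generic_def
proof (intro ballI impI)
  fix a j assume a: "a \<in> relations k (block_sum l x) {0}"
    and card: "card ((\<lambda>i. \<bar>a i\<bar>) ` {1..k} - {0}) \<le> d" and j: "j \<in> {1..k}"
  define A where "A i = (\<Sum>j=1..k. if i \<in> block l j then a j else 0)" for i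
  have A_in: "A i = a j" if "i \<in> block l j" "j \<in> {1..k}" for i j
  proof -
    have "i \<in> block l j' \<longleftrightarrow> j' = j" for j' using that(1) block_unique by blast
    then show ?thesis using that(2) by (simp add: A_def)
  qed
  have A_out: "A i = 0" if "i \<notin> (\<Union>j\<in>{1..k}. block l j)" for i
    unfolding A_def using that by (intro sum.neutral) auto
  have "(\<Sum>i=1..n. A i *\<^sub>R x i) = (\<Sum>i=1..n. \<Sum>j=1..k. if i \<in> block l j then a j *\<^sub>R x i else 0)"
    unfolding A_def scaleR_sum_left by (intro sum.cong) auto
  also have "\<dots> = (\<Sum>j=1..k. \<Sum>i=1..n. if i \<in> block l j then a j *\<^sub>R x i else 0)"
    by (rule sum.swap)
  also have "\<dots> = (\<Sum>j=1..k. a j *\<^sub>R block_sum l x j)"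
  proof (rule sum.cong)
    fix j assume "j \<in> {1..k}"
    then have "block l j \<subseteq> {1..n}" using block_subset[OF l] by blast
    then show "(\<Sum>i=1..n. if i \<in> block l j then a j *\<^sub>R x i else 0) = a j *\<^sub>R block_sum l x j"
      unfolding block_sum_def scaleR_sum_right
      by (simp add: sum.If_cases Int_absorb1)
  qed simp
  also have "\<dots> = 0" using a by (simp add: relations_def)
  finally have A: "A \<in> relations n x {0}" by (simp add: relations_def)
  have "\<bar>A i\<bar> \<in> insert 0 ((\<lambda>i. \<bar>a i\<bar>) ` {1..k})" for i
    using A_in[of i] A_out[of i] by (cases "i \<in> (\<Union>j\<in>{1..k}. block l j)") auto
  then have "(\<lambda>i. \<bar>A i\<bar>) ` {1..n} - {0} \<subseteq> (\<lambda>i. \<bar>a i\<bar>) ` {1..k} - {0}" by blast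
  then have "card ((\<lambda>i. \<bar>A i\<bar>) ` {1..n} - {0}) \<le> card ((\<lambda>i. \<bar>a i\<bar>) ` {1..k} - {0})"
    by (rule card_mono[rotated]) simp
  then have small: "card ((\<lambda>i. \<bar>A i\<bar>) ` {1..n} - {0}) \<le> d" using card by simp
  have "block_end l (j - 1) < block_end l j" using block_end_strict[OF l, of "j - 1" j] j by auto
  then have "block_end l j \<in> block l j" by (simp add: block_def)
  then show "a j = 0"
    using genericD[OF gen A small, of "block_end l j"] A_in j block_subset[OF l j] by auto
qed

text \<open>Sorting a relation by absolute value and summing by parts puts it on the positions where
  that value jumps. With at most d nonzero values there are at most d jumps, and independence
  removes them all.\<close>

lemma generic_if_walks_independent:
  fixes x :: "nat \<Rightarrow> 'v::real_vector"
  assumes "d \<le> n"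
    and indep: "\<And>h J. h \<in> signed_perms n \<Longrightarrow> J \<subseteq> {1..n} \<Longrightarrow> card J = d \<Longrightarrow>
      \<not> dependent_family J (walk (signed_permute h x))"
  shows "generic d n x {0}"
  unfolding generic_def
proof (intro ballI impI)
  fix a i assume a: "a \<in> relations n x {0}"
    and card: "card ((\<lambda>i. \<bar>a i\<bar>) ` {1..n} - {0}) \<le> d" and i: "i \<in> {1..n}"
  obtain \<sigma> where \<sigma>: "\<sigma> permutes {1..n}"
    "\<forall>i\<in>{1..n}. \<forall>j\<in>{1..n}. i < j \<longrightarrow> \<bar>a (\<sigma> j)\<bar> \<le> \<bar>a (\<sigma> i)\<bar>"
    using sorting_permutation[of n "\<lambda>i. \<bar>a i\<bar>"] by blast
  define \<epsilon> where "\<epsilon> = (\<lambda>i\<in>{1..n}. if a (\<sigma> i) < 0 then -1 else 1 :: real)"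
  have h: "(\<sigma>, \<epsilon>) \<in> signed_perms n" using \<sigma>(1) by (auto simp: signed_perms_def \<epsilon>_def)
  let ?S = "walk (signed_permute (\<sigma>, \<epsilon>) x)"
  define c where "c j = (if j \<le> n then \<bar>a (\<sigma> j)\<bar> else 0)" for j
  define J where "J = {m\<in>{1..n}. c m - c (Suc m) \<noteq> 0}"
  have c_dec: "c j \<le> c i" if "i < j" "1 \<le> i" for i j using \<sigma>(2) that by (auto simp: c_def)
  have "inj_on c J"
  proof (rule linorder_inj_onI)
    fix i j assume ij: "i < j" "i \<in> J" "j \<in> J"
    then have "c j \<le> c (Suc i)" using c_dec[of "Suc i" j] by (cases "j = Suc i") auto
    moreover have "c (Suc i) \<le> c i" "c i \<noteq> c (Suc i)" using ij c_dec[of i "Suc i"] by (auto simp: J_def)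
    ultimately show "c i \<noteq> c j" by simp
  qed auto
  moreover have "c ` J \<subseteq> (\<lambda>i. \<bar>a i\<bar>) ` {1..n} - {0}"
  proof
    fix y assume "y \<in> c ` J"
    then obtain m where m: "m \<in> J" "y = c m" by blast
    then have "m \<in> {1..n}" "c m \<noteq> c (Suc m)" by (auto simp: J_def)
    moreover have "0 \<le> c (Suc m)" "c (Suc m) \<le> c m" using c_dec[of m "Suc m"] calculation by (auto simp: c_def)
    ultimately show "y \<in> (\<lambda>i. \<bar>a i\<bar>) ` {1..n} - {0}"
      using m permutes_in_image[OF \<sigma>(1), of m] by (auto simp: c_def)
  qed
  ultimately have "card J \<le> card ((\<lambda>i. \<bar>a i\<bar>) ` {1..n} - {0})"
    by (intro card_inj_on_le) auto
  then have "card J \<le> d" using card by simp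
  moreover have J: "J \<subseteq> {1..n}" by (auto simp: J_def)
  \<comment> \<open>Independence is given for exactly d positions, so the set of jumps is
    padded.\<close>
  ultimately obtain K where K: "J \<subseteq> K" "K \<subseteq> {1..n}" "card K = d"
    using exists_subset_between[of J d "{1..n}"] \<open>d \<le> n\<close> by auto
  have finK: "finite K" using K finite_subset by blast
  have "(\<Sum>m=1..n. (c m - c (Suc m)) *\<^sub>R ?S m) = (\<Sum>j=1..n. c j *\<^sub>R signed_permute (\<sigma>, \<epsilon>) x j)"
    unfolding summation_by_parts by (simp add: c_def)
  also have "\<dots> = (\<Sum>j=1..n. a (\<sigma> j) *\<^sub>R x (\<sigma> j))"
    by (intro sum.cong) (auto simp: c_def signed_permute_def \<epsilon>_def)
  also have "\<dots> = 0"
    using sum.permute[OF \<sigma>(1), of "\<lambda>i. a i *\<^sub>R x i"] a by (simp add: o_def relations_def)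
  also have "(\<Sum>m=1..n. (c m - c (Suc m)) *\<^sub>R ?S m) = (\<Sum>m\<in>K. (c m - c (Suc m)) *\<^sub>R ?S m)"
    using K by (intro sum.mono_neutral_right) (auto simp: J_def)
  finally have zero: "(\<Sum>m\<in>K. (c m - c (Suc m)) *\<^sub>R ?S m) = 0" .
  have "c m - c (Suc m) = 0" if "m \<in> K" for m
  proof (rule ccontr)
    assume "c m - c (Suc m) \<noteq> 0"
    then have "dependent_family K ?S"
      unfolding dependent_family_def using zero that
      by (intro exI[of _ "\<lambda>m. c m - c (Suc m)"] conjI bexI[of _ m])
    then show False using indep[OF h K(2,3)] by contradiction
  qed
  then have step: "c m = c (Suc m)" if "m \<in> {1..n}" for m using K that by (fastforce simp: J_def)
  obtain j where j: "j \<in> {1..n}" "i = \<sigma> j" using signed_permsD(4)[OF h i] by blast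
  have "c m = 0" if "m \<le> Suc n" "j \<le> m" for m
    using that
  proof (induction m rule: inc_induct)
    case base
    show ?case by (simp add: c_def)
  next
    case (step m)
    then show ?case using \<open>\<And>m. m \<in> {1..n} \<Longrightarrow> c m = c (Suc m)\<close>[of m] j by simp
  qed
  then have "c j = 0" using j by simp
  then show "a i = 0" using j by (simp add: c_def)
qed

lemma bij_betw_match_families:
  fixes A B :: "'k \<Rightarrow> 'a set"
  assumes "finite K" "\<And>j. j \<in> K \<Longrightarrow> finite (A j)" "\<And>j. j \<in> K \<Longrightarrow> finite (B j)"
    and "\<And>j. j \<in> K \<Longrightarrow> card (A j) = card (B j)"
    and disjA: "\<And>i j x. i \<in> K \<Longrightarrow> j \<in> K \<Longrightarrow> x \<in> A i \<Longrightarrow> x \<in> A j \<Longrightarrow> i = j"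
    and disjB: "\<And>i j x. i \<in> K \<Longrightarrow> j \<in> K \<Longrightarrow> x \<in> B i \<Longrightarrow> x \<in> B j \<Longrightarrow> i = j"
  obtains f where "\<And>j. j \<in> K \<Longrightarrow> bij_betw f (A j) (B j)"
    "bij_betw f (\<Union>j\<in>K. A j) (\<Union>j\<in>K. B j)"
proof -
  have "\<exists>g. \<forall>j\<in>K. bij_betw (g j) (A j) (B j)"
    using assms(2-4) finite_same_card_bij by (intro bchoice) blast
  then obtain g where g: "\<And>j. j \<in> K \<Longrightarrow> bij_betw (g j) (A j) (B j)" by blast
  define f where "f x = g (THE j. j \<in> K \<and> x \<in> A j) x" for x
  have "f x = g j x" if "j \<in> K" "x \<in> A j" for j x
  proof -
    have "(THE j. j \<in> K \<and> x \<in> A j) = j" using that disjA by (intro the_equality) auto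
    then show ?thesis by (simp add: f_def)
  qed
  then have f: "bij_betw f (A j) (B j)" if "j \<in> K" for j
    using g[OF that] that bij_betw_cong by metis
  have img: "f ` A j = B j" if "j \<in> K" for j using f[OF that] by (simp add: bij_betw_def)
  have "inj_on f (\<Union>j\<in>K. A j)"
  proof (rule inj_onI)
    fix x y assume "x \<in> (\<Union>j\<in>K. A j)" "y \<in> (\<Union>j\<in>K. A j)" and eq: "f x = f y"
    then obtain i j where ij: "i \<in> K" "x \<in> A i" "j \<in> K" "y \<in> A j" by blast
    then have "f x \<in> B i" "f y \<in> B j" using img by blast+
    then have "i = j" using disjB ij eq by metis
    then show "x = y" using f[OF ij(1)] ij eq by (auto simp: bij_betw_def dest: inj_onD)
  qed
  moreover have "f ` (\<Union>j\<in>K. A j) = (\<Union>j\<in>K. B j)" using img by (simp add: image_UN)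
  ultimately show ?thesis by (intro that[OF f]) (simp_all add: bij_betw_def)
qed

text \<open>A signed permutation of blocks comes from one of the steps, provided the lengths are
  permuted too: the new block \<open>j\<close> is then as long as the old block
  \<open>\<sigma> j\<close>. Signs are constant on blocks, and steps past the last block stay
  put.\<close>

lemma signed_permute_blocks:
  assumes l: "l \<in> block_sizes n k" and h: "(\<sigma>, \<epsilon>) \<in> signed_perms k"
  obtains g where "g \<in> signed_perms n"
    "\<And>(x :: nat \<Rightarrow> 'v::real_vector) j. j \<in> {1..k} \<Longrightarrow>
      block_sum (l \<circ> \<sigma>) (signed_permute g x) j = signed_permute (\<sigma>, \<epsilon>) (block_sum l x) j"
proof -
  note hD = signed_permsD[OF h]
  let ?l = "l \<circ> \<sigma>"
  have l': "?l \<in> block_sizes n k" using block_sizes_permute[OF l hD(1)] .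
  have card: "card (block ?l j) = card (block l (\<sigma> j))" if "j \<in> {1..k}" for j
    using that hD(3)[OF that] by (simp add: card_block)
  have disj: "i = j" if "y \<in> block l (\<sigma> i)" "y \<in> block l (\<sigma> j)" for i j y
    using block_unique[OF that] permutes_inj[OF hD(1)] by (simp add: inj_eq)
  obtain f where f: "\<And>j. j \<in> {1..k} \<Longrightarrow> bij_betw f (block ?l j) (block l (\<sigma> j))"
    "bij_betw f (\<Union>j\<in>{1..k}. block ?l j) (\<Union>j\<in>{1..k}. block l (\<sigma> j))"
    by (rule bij_betw_match_families[of "{1..k}" "block ?l" "\<lambda>j. block l (\<sigma> j)"])
      (use card disj in \<open>auto intro: block_unique\<close>)
  have "(\<Union>j\<in>{1..k}. block l (\<sigma> j)) = (\<Union>j\<in>\<sigma> ` {1..k}. block l j)" by simp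
  also have "\<dots> = {1..block_end l k}" unfolding permutes_image[OF hD(1)] UN_block ..
  finally have Ul: "(\<Union>j\<in>{1..k}. block l (\<sigma> j)) = {1..block_end l k}" .
  have "block_end ?l k = block_end l k"
    using sum.permute[OF hD(1), of l] by (simp add: block_end_def o_def)
  then have fN: "bij_betw f {1..block_end l k} {1..block_end l k}"
    using f(2) unfolding Ul UN_block by simp
  define N where "N = block_end l k"
  have N: "N \<le> n" using l by (simp add: N_def block_sizes_def)
  define \<tau> where "\<tau> i = (if i \<in> {1..N} then f i else i)" for i
  have "bij_betw \<tau> {1..N} {1..N}"
    using fN bij_betw_cong[of "{1..N}" \<tau> f] by (simp add: \<tau>_def N_def)
  then have "\<tau> permutes {1..N}" by (rule bij_imp_permutes) (auto simp: \<tau>_def)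
  then have \<tau>: "\<tau> permutes {1..n}" by (rule permutes_subset) (use N in auto)
  define \<delta> where "\<delta> = (\<lambda>i\<in>{1..n}. if \<exists>j\<in>{1..k}. i \<in> block ?l j
    then \<epsilon> (THE j. i \<in> block ?l j) else 1)"
  have \<delta>: "\<delta> i = \<epsilon> j" if "j \<in> {1..k}" "i \<in> block ?l j" for i j
  proof -
    have "(THE j. i \<in> block ?l j) = j" using that block_unique by (intro the_equality) auto
    then show ?thesis using that block_subset[OF l' that(1)] by (auto simp: \<delta>_def)
  qed
  have "\<delta> i \<in> {-1, 1}" if i: "i \<in> {1..n}" for i
  proof (cases "\<exists>j\<in>{1..k}. i \<in> block ?l j")
    case True
    then show ?thesis using \<delta> hD(2) by (metis insert_iff)
  next
    case False
    then show ?thesis using i by (simp add: \<delta>_def)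
  qed
  then have "\<delta> \<in> {1..n} \<rightarrow>\<^sub>E {-1, 1}" by (auto simp: \<delta>_def)
  then have "(\<tau>, \<delta>) \<in> signed_perms n" using \<tau> by (simp add: signed_perms_def)
  moreover have "block_sum ?l (signed_permute (\<tau>, \<delta>) x) j = signed_permute (\<sigma>, \<epsilon>) (block_sum l x) j"
    if j: "j \<in> {1..k}" for x :: "nat \<Rightarrow> 'v" and j
  proof -
    have "block_sum ?l (signed_permute (\<tau>, \<delta>) x) j = (\<Sum>i\<in>block ?l j. \<epsilon> j *\<^sub>R x (f i))"
      unfolding block_sum_def
    proof (rule sum.cong)
      fix i assume i: "i \<in> block ?l j"
      then have "i \<in> {1..N}" using UN_block[of ?l k] j \<open>block_end ?l k = _\<close> by (auto simp: N_def)
      then show "signed_permute (\<tau>, \<delta>) x i = \<epsilon> j *\<^sub>R x (f i)"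
        using \<delta>[OF j i] by (simp add: signed_permute_def \<tau>_def)
    qed simp
    also have "\<dots> = \<epsilon> j *\<^sub>R (\<Sum>i\<in>block ?l j. x (f i))" by (simp add: scaleR_sum_right)
    also have "(\<Sum>i\<in>block ?l j. x (f i)) = (\<Sum>i\<in>block l (\<sigma> j). x i)"
      by (rule sum.reindex_bij_betw[OF f(1)[OF j]])
    finally show ?thesis by (simp only: signed_permute_def block_sum_def fst_conv snd_conv)
  qed
  ultimately show ?thesis using that by blast
qed

section \<open>Exchangeable walks\<close>

text \<open>Separation from the compact hull replaces it by finitely many strict inequalities in
  \<open>u\<close>, a form suited to measurability.\<close>

lemma zero_notin_hull_iff_half_space:
  fixes S :: "'i \<Rightarrow> 'v::euclidean_space"
  assumes "finite I"
  shows "0 \<notin> convex hull (S ` I) \<longleftrightarrow> (\<exists>u. \<forall>i\<in>I. u \<bullet> S i > 0)"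
proof
  assume "0 \<notin> convex hull (S ` I)"
  moreover have "closed (convex hull (S ` I))"
    using assms by (intro compact_imp_closed finite_imp_compact_convex_hull) auto
  ultimately obtain u b where "b > 0" "\<forall>x\<in>convex hull (S ` I). u \<bullet> x > b"
    using separating_hyperplane_closed_0[OF convex_convex_hull] by metis
  then have "\<forall>i\<in>I. u \<bullet> S i > 0" by (metis hull_inc imageI less_trans)
  then show "\<exists>u. \<forall>i\<in>I. u \<bullet> S i > 0" ..
next
  assume "\<exists>u. \<forall>i\<in>I. u \<bullet> S i > 0"
  then obtain u where u: "\<forall>i\<in>I. u \<bullet> S i > 0" ..
  have "convex hull (S ` I) \<subseteq> {x. u \<bullet> x > 0}"
    using u by (intro hull_minimal) (auto simp: convex_halfspace_gt)
  then show "0 \<notin> convex hull (S ` I)" by auto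
qed

text \<open>
  The admissible directions form an open set, so a countable dense set of them suffices.
\<close>
lemma zero_notin_hull_measurable:
  fixes S :: "'i \<Rightarrow> 'a \<Rightarrow> 'v::euclidean_space"
  assumes "finite I" and S: "\<And>i. i \<in> I \<Longrightarrow> S i \<in> borel_measurable N"
  shows "Measurable.pred N (\<lambda>x. 0 \<notin> convex hull ((\<lambda>i. S i x) ` I))"
proof -
  obtain D :: "'v set" where D: "countable D" "\<And>X. open X \<Longrightarrow> X \<noteq> {} \<Longrightarrow> \<exists>d\<in>D. d \<in> X"
    using countable_dense_setE by blast
  have "(\<exists>u. \<forall>i\<in>I. u \<bullet> S i x > 0) \<longleftrightarrow> (\<exists>u\<in>D. \<forall>i\<in>I. u \<bullet> S i x > 0)" for x
  proof -
    have "open (\<Inter>i\<in>I. {u. u \<bullet> S i x > 0})"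
      using assms(1) by (intro open_INT) (auto simp: open_halfspace_gt inner_commute[of _ "S _ x"])
    moreover have "(\<Inter>i\<in>I. {u. u \<bullet> S i x > 0}) = {u. \<forall>i\<in>I. u \<bullet> S i x > 0}" by auto
    ultimately show ?thesis using D(2)[of "{u. \<forall>i\<in>I. u \<bullet> S i x > 0}"] by auto
  qed
  then have "(\<lambda>x. 0 \<notin> convex hull ((\<lambda>i. S i x) ` I)) = (\<lambda>x. \<exists>u\<in>D. \<forall>i\<in>I. u \<bullet> S i x > 0)"
    unfolding zero_notin_hull_iff_half_space[OF assms(1)] by (rule ext)
  moreover have "Measurable.pred N (\<lambda>x. \<exists>u\<in>D. \<forall>i\<in>I. u \<bullet> S i x > 0)"
    unfolding pred_def
  proof (rule sets.sets_Collect_countable_Ex'[OF _ D(1)], fold pred_def)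
    fix u
    show "Measurable.pred N (\<lambda>x. \<forall>i\<in>I. u \<bullet> S i x > 0)"
    proof (rule pred_intros_finite[OF assms(1)])
      fix i assume "i \<in> I"
      then have [measurable]: "S i \<in> borel_measurable N" by (rule S)
      show "Measurable.pred N (\<lambda>x. u \<bullet> S i x > 0)" by measurable
    qed
  qed
  ultimately show ?thesis by simp
qed

lemma dependent_family_iff_det:
  fixes v :: "'i \<Rightarrow> real ^ 'd"
  assumes "bij_betw f (UNIV :: 'd set) J"
  shows "dependent_family J v \<longleftrightarrow> det (\<chi> r. v (f r)) = 0"
proof -
  let ?A = "\<chi> r. v (f r)"
  have "det ?A \<noteq> 0 \<longleftrightarrow> (\<forall>c. (\<Sum>r\<in>UNIV. c r *s row r ?A) = 0 \<longrightarrow> (\<forall>r. c r = 0))"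
    unfolding invertible_det_nz[symmetric] invertible_right_inverse
    by (rule matrix_right_invertible_independent_rows)
  also have "\<dots> \<longleftrightarrow> (\<forall>c. (\<Sum>r\<in>UNIV. c r *\<^sub>R v (f r)) = 0 \<longrightarrow> (\<forall>r. c r = 0))"
    by (simp add: row_def scalar_mult_eq_scaleR vec_lambda_eta)
  also have "\<dots> \<longleftrightarrow> \<not> dependent_family J v"
  proof
    assume *: "\<forall>c. (\<Sum>r\<in>UNIV. c r *\<^sub>R v (f r)) = 0 \<longrightarrow> (\<forall>r. c r = 0)"
    show "\<not> dependent_family J v"
    proof
      assume "dependent_family J v"
      then obtain c i where c: "i \<in> J" "c i \<noteq> 0" "(\<Sum>i\<in>J. c i *\<^sub>R v i) = 0"
        by (auto simp: dependent_family_def)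
      have "(\<Sum>r\<in>UNIV. c (f r) *\<^sub>R v (f r)) = 0"
        using sum.reindex_bij_betw[OF assms, of "\<lambda>i. c i *\<^sub>R v i"] c by simp
      then have "\<forall>r. c (f r) = 0" using *[rule_format, of "\<lambda>r. c (f r)"] by simp
      then show False using c assms by (auto simp: bij_betw_def)
    qed
  next
    assume nd: "\<not> dependent_family J v"
    show "\<forall>c. (\<Sum>r\<in>UNIV. c r *\<^sub>R v (f r)) = 0 \<longrightarrow> (\<forall>r. c r = 0)"
    proof (intro allI impI)
      fix c r assume c: "(\<Sum>r\<in>UNIV. c r *\<^sub>R v (f r)) = 0"
      define g where "g = inv f"
      have g: "g (f r) = r" for r using assms by (simp add: g_def bij_betw_def)
      have "(\<Sum>i\<in>J. c (g i) *\<^sub>R v i) = (\<Sum>r\<in>UNIV. c (g (f r)) *\<^sub>R v (f r))"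
        by (rule sum.reindex_bij_betw[OF assms, symmetric])
      then have "(\<Sum>i\<in>J. c (g i) *\<^sub>R v i) = 0" using c g by simp
      then have "dependent_family J v" if "c r \<noteq> 0"
        unfolding dependent_family_def using that g bij_betwE[OF assms]
        by (intro exI[of _ "\<lambda>i. c (g i)"] conjI bexI[of _ "f r"]) auto
      then show "c r = 0" using nd by blast
    qed
  qed
  finally show ?thesis by blast
qed

text \<open>Dependence is the vanishing of a determinant. Measurability is essential because
  \<open>measure\<close> is 0 on non-measurable sets by default; only with it does
  \<open>general_position\<close> give null sets.\<close>

lemma dependent_family_measurable:
  fixes S :: "'i \<Rightarrow> 'a \<Rightarrow> real ^ 'd"
  assumes J: "card J = CARD('d)" and S: "\<And>i. i \<in> J \<Longrightarrow> S i \<in> borel_measurable N"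
  shows "Measurable.pred N (\<lambda>x. dependent_family J (\<lambda>i. S i x))"
proof -
  have "finite J" using J by (metis card.infinite zero_less_card_finite less_irrefl)
  then obtain f where f: "bij_betw f (UNIV :: 'd set) J"
    using finite_same_card_bij[of "UNIV :: 'd set" J] J by auto
  have [measurable]: "S (f r) \<in> borel_measurable N" for r
    using f by (intro S) (auto simp: bij_betw_def)
  have [measurable]: "(\<lambda>x. S (f r) x $ c) \<in> borel_measurable N" for r c
    by (rule measurable_compose[OF _ borel_measurable_nth]) measurable
  have [measurable]: "(\<lambda>x. det (\<chi> r. S (f r) x)) \<in> borel_measurable N"
    unfolding det_def vec_lambda_beta by measurable
  then have "Measurable.pred N (\<lambda>x. det (\<chi> r. S (f r) x) = 0)" by measurable
  then show ?thesis unfolding dependent_family_iff_det[OF f] .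
qed

section \<open>The random walk\<close>

locale exchangeable_walk = prob_space M for M :: "'w measure" +
  fixes n :: nat and \<xi> :: "nat \<Rightarrow> 'w \<Rightarrow> real ^ 'd"
  assumes \<xi>_measurable: "\<And>i. i \<in> {1..n} \<Longrightarrow> \<xi> i \<in> borel_measurable M"
    and exchangeable: "symmetrically_exchangeable M n \<xi>"
    and general: "general_position M CARD('d) n \<xi>"
    and d_le_n: "CARD('d) \<le> n"
begin

abbreviation path :: "'w \<Rightarrow> nat \<Rightarrow> real ^ 'd" where
  "path \<omega> \<equiv> (\<lambda>i. \<xi> i \<omega>)"

lemma signed_permute_measurable:
  assumes "h \<in> signed_perms n" "i \<in> {1..n}"
  shows "(\<lambda>\<omega>. signed_permute h (path \<omega>) i) \<in> borel_measurable M"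
proof -
  obtain \<sigma> \<epsilon> where h: "h = (\<sigma>, \<epsilon>)" by (cases h)
  have [measurable]: "\<xi> (\<sigma> i) \<in> borel_measurable M"
    using signed_permsD(3)[OF assms(1)[unfolded h] assms(2)] by (rule \<xi>_measurable)
  show ?thesis by (simp add: signed_permute_def h)
qed

text \<open>Exchangeability compares restricted tuples, so \<open>local\<close> is needed to pass
  back to whole paths.\<close>

lemma prob_signed_permute:
  assumes h: "h \<in> signed_perms n"
    and Q: "Measurable.pred (\<Pi>\<^sub>M i\<in>{1..n}. borel) Q"
    and local: "\<And>x y. (\<And>i. i \<in> {1..n} \<Longrightarrow> x i = y i) \<Longrightarrow> Q x \<longleftrightarrow> Q y"
  shows "prob {\<omega>\<in>space M. Q (signed_permute h (path \<omega>))} = prob {\<omega>\<in>space M. Q (path \<omega>)}"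
proof -
  obtain \<sigma> \<epsilon> where h': "h = (\<sigma>, \<epsilon>)" by (cases h)
  let ?N = "\<Pi>\<^sub>M i\<in>{1..n}. (borel :: (real ^ 'd) measure)"
  let ?X = "\<lambda>\<omega>. \<lambda>i\<in>{1..n}. \<xi> i \<omega>" and ?Y = "\<lambda>\<omega>. \<lambda>i\<in>{1..n}. \<epsilon> i *\<^sub>R \<xi> (\<sigma> i) \<omega>"
  let ?A = "{x\<in>space ?N. Q x}"
  have X: "?X \<in> measurable M ?N" by (intro measurable_restrict \<xi>_measurable)
  have Y: "?Y \<in> measurable M ?N"
    using signed_permute_measurable[OF h]
    by (intro measurable_restrict) (simp add: signed_permute_def h')
  have A: "?A \<in> sets ?N" using Q by measurable
  have "distr M ?N ?X = distr M ?N ?Y"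
    using exchangeable signed_permsD(1,2)[OF h[unfolded h']]
    unfolding symmetrically_exchangeable_def by blast
  then have "measure (distr M ?N ?X) ?A = measure (distr M ?N ?Y) ?A" by simp
  then have "prob (?X -` ?A \<inter> space M) = prob (?Y -` ?A \<inter> space M)"
    by (simp only: measure_distr[OF X A] measure_distr[OF Y A])
  moreover have "?X -` ?A \<inter> space M = {\<omega>\<in>space M. Q (path \<omega>)}"
    using measurable_space[OF X] local[of "?X _" "path _"] by auto
  moreover have "?Y -` ?A \<inter> space M = {\<omega>\<in>space M. Q (signed_permute h (path \<omega>))}"
    using measurable_space[OF Y] local[of "?Y _" "signed_permute h (path _)"]
    by (auto simp: signed_permute_def h')
  ultimately show ?thesis by simp
qed

lemma walk_measurable_PiM:
  assumes "m \<le> n"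
  shows "(\<lambda>x. walk x m) \<in> borel_measurable (\<Pi>\<^sub>M i\<in>{1..n}. (borel :: (real ^ 'd) measure))"
  unfolding walk_def using assms
  by (intro borel_measurable_sum measurable_component_singleton) auto

text \<open>Each signed permutation inherits general position by equality of laws, and there are
  only finitely many permutations and index sets.\<close>

lemma AE_generic: "AE \<omega> in M. generic CARD('d) n (path \<omega>) {0}"
proof -
  let ?P = "\<lambda>h J \<omega>. dependent_family J (walk (signed_permute h (path \<omega>)))"
  have ae: "AE \<omega> in M. \<not> ?P h J \<omega>"
    if h: "h \<in> signed_perms n" and J: "J \<subseteq> {1..n}" "card J = CARD('d)" for h J
  proof -
    have "prob {\<omega>\<in>space M. ?P h J \<omega>} = prob {\<omega>\<in>space M. dependent_family J (walk (path \<omega>))}"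
    proof (rule prob_signed_permute[OF h])
      show "Measurable.pred (\<Pi>\<^sub>M i\<in>{1..n}. borel) (\<lambda>x :: nat \<Rightarrow> real ^ 'd. dependent_family J (walk x))"
        using J by (intro dependent_family_measurable walk_measurable_PiM) auto
      fix x y :: "nat \<Rightarrow> real ^ 'd" assume "\<And>i. i \<in> {1..n} \<Longrightarrow> x i = y i"
      then have "walk x i = walk y i" if "i \<in> J" for i
        using that J unfolding walk_def by (intro sum.cong) auto
      then show "dependent_family J (walk x) \<longleftrightarrow> dependent_family J (walk y)"
        unfolding dependent_family_def by (simp cong: sum.cong)
    qed
    also have "\<dots> = 0"
      using general J unfolding general_position_def by (simp add: partial_sum_def walk_def[abs_def])
    finally have zero: "prob {\<omega>\<in>space M. ?P h J \<omega>} = 0" .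
    have "Measurable.pred M (\<lambda>\<omega>. ?P h J \<omega>)"
    proof (intro dependent_family_measurable J)
      fix m assume "m \<in> J"
      then show "(\<lambda>\<omega>. walk (signed_permute h (path \<omega>)) m) \<in> borel_measurable M"
        unfolding walk_def using J
        by (intro borel_measurable_sum signed_permute_measurable[OF h]) auto
    qed
    then have "{\<omega>\<in>space M. ?P h J \<omega>} \<in> events" by measurable
    then have "AE \<omega> in M. \<omega> \<notin> {\<omega>\<in>space M. ?P h J \<omega>}" using zero prob_eq_0 by blast
    then show ?thesis by (rule AE_mp) (intro AE_I2, simp)
  qed
  have "AE \<omega> in M. \<forall>h\<in>signed_perms n. \<forall>J\<in>{J. J \<subseteq> {1..n} \<and> card J = CARD('d)}. \<not> ?P h J \<omega>"
    using ae by (intro AE_finite_allI) auto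
  then show ?thesis
  proof (rule AE_mp, intro AE_I2 impI)
    fix \<omega> assume *: "\<forall>h\<in>signed_perms n. \<forall>J\<in>{J. J \<subseteq> {1..n} \<and> card J = CARD('d)}. \<not> ?P h J \<omega>"
    show "generic CARD('d) n (path \<omega>) {0}"
      using * by (intro generic_if_walks_independent[OF d_le_n]) auto
  qed
qed

lemma block_sum_measurable:
  assumes "l \<in> block_sizes n k" "j \<in> {1..k}"
  shows "(\<lambda>\<omega>. block_sum l (path \<omega>) j) \<in> borel_measurable M"
  unfolding block_sum_def using block_subset[OF assms]
  by (intro borel_measurable_sum \<xi>_measurable) auto

definition avoid_prob :: "nat set \<Rightarrow> real" where
  "avoid_prob I = prob {\<omega>\<in>space M. 0 \<notin> convex hull (walk (path \<omega>) ` I)}"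

lemma avoid_prob_permute_blocks:
  assumes l: "l \<in> block_sizes n k" and h: "(\<sigma>, \<epsilon>) \<in> signed_perms k"
  shows "avoid_prob (block_end (l \<circ> \<sigma>) ` {1..k}) =
    prob {\<omega>\<in>space M. 0 \<notin> convex hull (walk (signed_permute (\<sigma>, \<epsilon>) (block_sum l (path \<omega>))) ` {1..k})}"
proof -
  let ?I = "block_end (l \<circ> \<sigma>) ` {1..k}"
  have "l \<circ> \<sigma> \<in> block_sizes n k" using block_sizes_permute l signed_permsD(1)[OF h] .
  from bij_betw_apply[OF bij_betw_block_ends this] have I: "?I \<subseteq> {1..n}" by blast
  obtain g where g: "g \<in> signed_perms n"
    "\<And>(x :: nat \<Rightarrow> real ^ 'd) j. j \<in> {1..k} \<Longrightarrow>
      block_sum (l \<circ> \<sigma>) (signed_permute g x) j = signed_permute (\<sigma>, \<epsilon>) (block_sum l x) j"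
    using signed_permute_blocks[OF l h] by blast
  have "walk (signed_permute g x) ` ?I = walk (signed_permute (\<sigma>, \<epsilon>) (block_sum l x)) ` {1..k}"
    for x :: "nat \<Rightarrow> real ^ 'd"
    unfolding image_image
  proof (rule image_cong)
    fix m assume "m \<in> {1..k}"
    then show "walk (signed_permute g x) (block_end (l \<circ> \<sigma>) m) =
        walk (signed_permute (\<sigma>, \<epsilon>) (block_sum l x)) m"
      unfolding walk_block_sum[symmetric] unfolding walk_def using g(2) by (intro sum.cong) auto
  qed simp
  moreover have "prob {\<omega>\<in>space M. 0 \<notin> convex hull (walk (signed_permute g (path \<omega>)) ` ?I)} =
      prob {\<omega>\<in>space M. 0 \<notin> convex hull (walk (path \<omega>) ` ?I)}"
  proof (rule prob_signed_permute[OF g(1)])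
    show "Measurable.pred (\<Pi>\<^sub>M i\<in>{1..n}. borel) (\<lambda>x::nat \<Rightarrow> real ^ 'd. 0 \<notin> convex hull (walk x ` ?I))"
      using I by (intro zero_notin_hull_measurable walk_measurable_PiM) auto
    fix x y :: "nat \<Rightarrow> real ^ 'd" assume "\<And>i. i \<in> {1..n} \<Longrightarrow> x i = y i"
    then have "walk x i = walk y i" if "i \<in> ?I" for i
      using subsetD[OF I that] unfolding walk_def by (intro sum.cong) auto
    then have "walk x ` ?I = walk y ` ?I" by (intro image_cong) auto
    then show "0 \<notin> convex hull (walk x ` ?I) \<longleftrightarrow> 0 \<notin> convex hull (walk y ` ?I)" by simp
  qed
  ultimately show ?thesis by (simp add: avoid_prob_def)
qed

text \<open>The sum is the expected number of signed permutations whose walk avoids zero, and that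
  number is almost surely constant.\<close>

lemma sum_avoid_prob_orbit:
  assumes l: "l \<in> block_sizes n k" and k: "k \<ge> 1"
  shows "(\<Sum>h\<in>signed_perms k. avoid_prob (block_end (l \<circ> fst h) ` {1..k})) = 2 * real_of_int (B_sum k CARD('d))"
proof -
  let ?E = "\<lambda>h \<omega>. 0 \<notin> convex hull (walk (signed_permute h (block_sum l (path \<omega>))) ` {1..k})"
  have meas: "{\<omega>\<in>space M. ?E h \<omega>} \<in> events" if h: "h \<in> signed_perms k" for h
  proof -
    obtain \<sigma> \<epsilon> where h': "h = (\<sigma>, \<epsilon>)" by (cases h)
    have "(\<lambda>\<omega>. signed_permute h (block_sum l (path \<omega>)) j) \<in> borel_measurable M" if "j \<in> {1..k}" for j
    proof -
      have [measurable]: "(\<lambda>\<omega>. block_sum l (path \<omega>) (\<sigma> j)) \<in> borel_measurable M"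
        using block_sum_measurable[OF l] signed_permsD(3) h h' that by blast
      show ?thesis by (simp add: signed_permute_def h')
    qed
    then have "Measurable.pred M (?E h)"
      unfolding walk_def by (intro zero_notin_hull_measurable borel_measurable_sum) auto
    then show ?thesis by measurable
  qed
  have "(\<Sum>h\<in>signed_perms k. avoid_prob (block_end (l \<circ> fst h) ` {1..k})) =
      (\<Sum>h\<in>signed_perms k. prob {\<omega>\<in>space M. ?E h \<omega>})"
    using avoid_prob_permute_blocks[OF l] by (intro sum.cong) auto
  also have "\<dots> = (\<Sum>h\<in>signed_perms k. expectation (indicator {\<omega>\<in>space M. ?E h \<omega>}))"
    using meas by (intro sum.cong) (auto simp: Int_absorb2 subset_eq)
  also have "\<dots> = expectation (\<lambda>\<omega>. \<Sum>h\<in>signed_perms k. indicator {\<omega>\<in>space M. ?E h \<omega>} \<omega>)"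
    using meas by (intro Bochner_Integration.integral_sum[symmetric]) (auto simp: emeasure_eq_measure)
  also have "\<dots> = expectation (\<lambda>\<omega>. 2 * real_of_int (B_sum k CARD('d)))"
  proof (rule integral_cong_AE)
    show "AE \<omega> in M. (\<Sum>h\<in>signed_perms k. indicator {\<omega>\<in>space M. ?E h \<omega>} \<omega>) =
        2 * real_of_int (B_sum k CARD('d))"
      using AE_generic
    proof (rule AE_mp, intro AE_I2 impI)
      fix \<omega> assume \<omega>: "\<omega> \<in> space M" "generic CARD('d) n (path \<omega>) {0}"
      have "generic DIM(real ^ 'd) k (block_sum l (path \<omega>)) {0}"
        using generic_block_sum[OF \<omega>(2) l] by simp
      from card_signed_perms_hull_avoids_zero[OF this k]
      have "int (card {h\<in>signed_perms k. ?E h \<omega>}) = 2 * B_sum k CARD('d)" by simp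
      then have "real (card {h\<in>signed_perms k. ?E h \<omega>}) = 2 * real_of_int (B_sum k CARD('d))"
        by linarith
      then show "(\<Sum>h\<in>signed_perms k. indicator {\<omega>\<in>space M. ?E h \<omega>} \<omega>) =
          2 * real_of_int (B_sum k CARD('d))"
        using \<omega>(1) by (simp add: indicator_def sum.If_cases Int_def of_bool_def)
    qed
  qed (use meas in auto)
  finally show ?thesis by (simp add: prob_space)
qed

text \<open>For unequal gaps the orbit identity fixes only a sum over several index sets. Summing it
  over all gap vectors counts every index set once for each signed permutation.\<close>

lemma sum_avoid_prob:
  assumes "1 \<le> k"
  shows "(\<Sum>I | I \<subseteq> {1..n} \<and> card I = k. avoid_prob I) =
    real (n choose k) * (2 * real_of_int (B_sum k CARD('d)) / (2 ^ k * fact k))"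
proof -
  let ?F = "\<lambda>l. avoid_prob (block_end l ` {1..k})"
  have sum: "(\<Sum>I | I \<subseteq> {1..n} \<and> card I = k. avoid_prob I) = (\<Sum>l\<in>block_sizes n k. ?F l)"
    by (rule sum.reindex_bij_betw[OF bij_betw_block_ends, symmetric])
  have card: "card (block_sizes n k) = n choose k"
    using bij_betw_same_card[OF bij_betw_block_ends[of k n]] n_subsets[of "{1..n}" k] by simp
  have "2 ^ k * fact k * (\<Sum>l\<in>block_sizes n k. ?F l) =
      (\<Sum>h\<in>signed_perms k. \<Sum>l\<in>block_sizes n k. ?F l)"
    by (simp add: card_signed_perms)
  also have "\<dots> = (\<Sum>h\<in>signed_perms k. \<Sum>l\<in>block_sizes n k. ?F (l \<circ> fst h))"
    by (intro sum.cong refl sum_block_sizes_permute[symmetric]) (auto simp: signed_perms_def)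
  also have "\<dots> = (\<Sum>l\<in>block_sizes n k. \<Sum>h\<in>signed_perms k. ?F (l \<circ> fst h))"
    by (rule sum.swap)
  also have "\<dots> = (\<Sum>l\<in>block_sizes n k. 2 * real_of_int (B_sum k CARD('d)))"
    using assms by (intro sum.cong refl sum_avoid_prob_orbit)
  also have "\<dots> = real (n choose k) * (2 * real_of_int (B_sum k CARD('d)))"
    by (simp add: card)
  finally show ?thesis unfolding sum by (simp add: field_simps)
qed

lemma avoid_prob_initial:
  assumes "k \<in> {1..n}"
  shows "avoid_prob {1..k} = 2 * real_of_int (B_sum k CARD('d)) / (2 ^ k * fact k)"
proof -
  \<comment> \<open>All gaps are 1, so permuting them changes nothing and the orbit sum consists of
    equal terms.\<close>
  define l where "l = (\<lambda>i\<in>{1..k}. 1 :: nat)"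
  have ends: "block_end l m = m" if "m \<le> k" for m
    using that by (induction m) (auto simp: l_def)
  have l: "l \<in> block_sizes n k" using assms ends[of k] by (auto simp: block_sizes_def l_def)
  have "l \<circ> fst h = l" if h: "h \<in> signed_perms k" for h
  proof
    fix i
    have "fst h i \<in> {1..k} \<longleftrightarrow> i \<in> {1..k}"
      using h by (intro permutes_in_image) (auto simp: signed_perms_def)
    then show "(l \<circ> fst h) i = l i" by (simp add: l_def restrict_def)
  qed
  moreover have "block_end l ` {1..k} = {1..k}" using ends by (auto simp: image_iff)
  ultimately have "2 ^ k * fact k * avoid_prob {1..k} = 2 * real_of_int (B_sum k CARD('d))"
    using sum_avoid_prob_orbit[OF l] assms by (simp add: card_signed_perms)
  then show ?thesis by (simp add: field_simps)
qed

lemma expectation_M_count: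
  assumes "m \<le> n"
  shows "expectation (M_count \<xi> m k) = 1 / 2 * (\<Sum>I | I \<subseteq> {1..m} \<and> card I = k. avoid_prob I)"
proof -
  let ?K = "{I. I \<subseteq> {1..m} \<and> card I = k}"
  let ?A = "\<lambda>I. {\<omega>\<in>space M. 0 \<notin> convex hull (walk (path \<omega>) ` I)}"
  have meas: "?A I \<in> events" if "I \<in> ?K" for I
  proof -
    have I: "finite I" "I \<subseteq> {1..n}" using that assms by (auto intro: finite_subset)
    have "Measurable.pred M (\<lambda>\<omega>. 0 \<notin> convex hull (walk (path \<omega>) ` I))"
      unfolding walk_def
      using I by (intro zero_notin_hull_measurable borel_measurable_sum \<xi>_measurable) auto
    then show ?thesis by measurable
  qed
  have "expectation (M_count \<xi> m k) = expectation (\<lambda>\<omega>. 1 / 2 * (\<Sum>I\<in>?K. indicator (?A I) \<omega>))"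
    by (intro Bochner_Integration.integral_cong)
      (auto simp: M_count_def partial_sum_def walk_def indicator_def intro!: sum.cong)
  also have "\<dots> = 1 / 2 * (\<Sum>I\<in>?K. expectation (indicator (?A I)))"
    using meas by (subst Bochner_Integration.integral_mult_right_zero,
      subst Bochner_Integration.integral_sum) (auto simp: emeasure_eq_measure)
  also have "(\<Sum>I\<in>?K. expectation (indicator (?A I))) = (\<Sum>I\<in>?K. avoid_prob I)"
    using meas by (intro sum.cong) (auto simp: avoid_prob_def Int_absorb2 subset_eq)
  finally show ?thesis .
qed

end

theorem theorem1p2:
  fixes M :: "'w measure"
    and \<xi> :: "nat \<Rightarrow> 'w \<Rightarrow> real ^ 'd"
    and d n k :: nat
  assumes "prob_space M"
    and "CARD('d) = d"
    and "n \<ge> d + 1"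
    and "\<And>i. i \<in> {1..n} \<Longrightarrow> \<xi> i \<in> borel_measurable M"
    and "symmetrically_exchangeable M n \<xi>"
    and "general_position M d n \<xi>"
    and "k \<in> {1..n}"
  shows "prob_space.expectation M (M_count \<xi> n k) =
           real (n choose k) * (real_of_int (B_sum k d) / (2 ^ k * fact k)) \<and>
         real (n choose k) * (real_of_int (B_sum k d) / (2 ^ k * fact k)) =
           real (n choose k) * prob_space.expectation M (M_count \<xi> k k)"
proof -
  interpret prob_space M by fact
  interpret exchangeable_walk M n \<xi>
    by unfold_locales (use assms in auto)
  have k: "1 \<le> k" "k \<le> n" using assms(7) by auto
  have "{I. I \<subseteq> {1..k} \<and> card I = k} = {{1..k}}"
    using card_subset_eq[of "{1..k}"] by auto
  then have "expectation (M_count \<xi> k k) = real_of_int (B_sum k d) / (2 ^ k * fact k)"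
    using expectation_M_count[OF k(2), of k] avoid_prob_initial[OF assms(7)] assms(2) by simp
  moreover have "expectation (M_count \<xi> n k) =
      real (n choose k) * (real_of_int (B_sum k d) / (2 ^ k * fact k))"
    unfolding expectation_M_count[OF order_refl] sum_avoid_prob[OF k(1)] assms(2) by simp
  ultimately show ?thesis by simp
qed

end
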